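(* Let $X$ be a CAT(1) space of finite dimension and of radius $r\le\frac{\pi}{2}$. Then $X$ has a circumcenter which is fixed by every isometry of $X$.
   Context: A complete metric space is called CAT(1) if each pair of points with distance $<\pi$ is connected by a geodesic and all geodesic triangles of perimeter less than $2\pi$ are not thicker than their comparison triangles in the unit sphere $S^2$. For a metric space $X$ and $x\in X$ put $\operatorname{rad}_x(X)=\sup_{z\in X}d(x,z)$; the radius of $X$ is $\operatorname{rad}(X)=\inf_{x\in X}\operatorname{rad}_x(X)$. A point $x\in X$ is a circumcenter of $X$ if $\operatorname{rad}_x(X)=\operatorname{rad}(X)$. The dimension is the geometric dimension in the sense of Kleiner: the supremum of the topological (covering) dimensions of compact subsets of $X$. (Equivalently it is defined inductively: $\dim X=0$ if $X$ is discrete, and otherwise $\dim X=\sup_{x}(1+\dim S_x)$ with $S_x$ the link, i.e. space of directions, at $x$.) Isometries of $X$ are understood to be surjective. *)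

theory Defs
  imports "HOL-Analysis.Analysis"
begin

text \<open>
  A metric space is given as a set \<open>X\<close> in a type of class \<^class>\<open>metric_space\<close>, with the
  restriction of \<^const>\<open>dist\<close>. Geodesics and triangles are defined for an arbitrary distance
  function so that they apply both to \<open>X\<close> and to the unit sphere with its angular metric.
\<close>

definition geodesic ::
  "('a \<Rightarrow> 'a \<Rightarrow> real) \<Rightarrow> 'a set \<Rightarrow> 'a \<Rightarrow> 'a \<Rightarrow> (real \<Rightarrow> 'a) \<Rightarrow> bool" where
  "geodesic d S x y c \<longleftrightarrow>
     c 0 = x \<and> c (d x y) = y \<and> c ` {0..d x y} \<subseteq> S \<and>
     (\<forall>s\<in>{0..d x y}. \<forall>t\<in>{0..d x y}. d (c s) (c t) = \<bar>s - t\<bar>)"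

text \<open>Vertices are indexed cyclically by the type \<open>3\<close> (where \<open>2 + 1 = 0\<close>).\<close>

definition geodesic_triangle ::
  "('a \<Rightarrow> 'a \<Rightarrow> real) \<Rightarrow> 'a set \<Rightarrow> (3 \<Rightarrow> 'a) \<Rightarrow> (3 \<Rightarrow> real \<Rightarrow> 'a) \<Rightarrow> bool" where
  "geodesic_triangle d S v c \<longleftrightarrow> (\<forall>i. geodesic d S (v i) (v (i + 1)) (c i))"

definition perimeter :: "('a \<Rightarrow> 'a \<Rightarrow> real) \<Rightarrow> (3 \<Rightarrow> 'a) \<Rightarrow> real" where
  "perimeter d v = (\<Sum>i\<in>UNIV. d (v i) (v (i + 1)))"

abbreviation S2 :: "(real ^ 3) set" where
  "S2 \<equiv> sphere 0 1"

definition sphere_dist :: "real ^ 3 \<Rightarrow> real ^ 3 \<Rightarrow> real" where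
  "sphere_dist u w = arccos (u \<bullet> w)"

text \<open>
  For a triangle of perimeter less than \<open>2 * pi\<close> the comparison triangle exists, and it is unique
  up to isometry of the sphere, so quantifying over all comparison triangles is harmless.
\<close>

definition not_thicker_than_comparison ::
  "(3 \<Rightarrow> 'a::metric_space) \<Rightarrow> (3 \<Rightarrow> real \<Rightarrow> 'a) \<Rightarrow> bool" where
  "not_thicker_than_comparison v c \<longleftrightarrow>
     (\<forall>v' c'. geodesic_triangle sphere_dist S2 v' c' \<and>
        (\<forall>i. sphere_dist (v' i) (v' (i + 1)) = dist (v i) (v (i + 1))) \<longrightarrow>
        (\<forall>i j. \<forall>s\<in>{0..dist (v i) (v (i + 1))}. \<forall>t\<in>{0..dist (v j) (v (j + 1))}.
           dist (c i s) (c j t) \<le> sphere_dist (c' i s) (c' j t)))"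

definition CAT1 :: "'a::metric_space set \<Rightarrow> bool" where
  "CAT1 X \<longleftrightarrow>
     complete X \<and>
     (\<forall>x\<in>X. \<forall>y\<in>X. dist x y < pi \<longrightarrow> (\<exists>c. geodesic dist X x y c)) \<and>
     (\<forall>v c. geodesic_triangle dist X v c \<and> perimeter dist v < 2 * pi \<longrightarrow>
        not_thicker_than_comparison v c)"

definition open_cover :: "'a topology \<Rightarrow> 'a set set \<Rightarrow> bool" where
  "open_cover T \<U> \<longleftrightarrow> (\<forall>U\<in>\<U>. openin T U) \<and> \<Union>\<U> = topspace T"

text \<open>
  \<open>refinable T m\<close>: every open cover has an open refinement in which each point lies in at most \<open>m\<close>
  members, that is, the covering dimension of \<open>T\<close> is at most \<open>m - 1\<close>. In particular the empty
  space has dimension \<open>-1\<close>.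
\<close>

definition refinable :: "'a topology \<Rightarrow> nat \<Rightarrow> bool" where
  "refinable T m \<longleftrightarrow>
     (\<forall>\<U>. open_cover T \<U> \<longrightarrow>
        (\<exists>\<V>. open_cover T \<V> \<and> (\<forall>V\<in>\<V>. \<exists>U\<in>\<U>. V \<subseteq> U) \<and>
             (\<forall>x\<in>topspace T. finite {V\<in>\<V>. x \<in> V} \<and> card {V\<in>\<V>. x \<in> V} \<le> m)))"

definition covering_dim :: "'a topology \<Rightarrow> ereal" where
  "covering_dim T = (INF m\<in>{m. refinable T m}. ereal (real m - 1))"

definition geometric_dim :: "'a::metric_space set \<Rightarrow> ereal" where
  "geometric_dim X = (SUP K\<in>{K. compact K \<and> K \<subseteq> X}. covering_dim (top_of_set K))"

definition radius_at :: "'a::metric_space set \<Rightarrow> 'a \<Rightarrow> ereal" where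
  "radius_at X x = (SUP z\<in>X. ereal (dist x z))"

text \<open>The empty space has radius \<open>\<infinity>\<close>.\<close>

definition radius :: "'a::metric_space set \<Rightarrow> ereal" where
  "radius X = (INF x\<in>X. radius_at X x)"

definition circumcenter :: "'a::metric_space set \<Rightarrow> 'a \<Rightarrow> bool" where
  "circumcenter X x \<longleftrightarrow> x \<in> X \<and> radius_at X x = radius X"

definition isometry_of :: "'a::metric_space set \<Rightarrow> ('a \<Rightarrow> 'a) \<Rightarrow> bool" where
  "isometry_of X f \<longleftrightarrow> f ` X = X \<and> (\<forall>x\<in>X. \<forall>y\<in>X. dist (f x) (f y) = dist x y)"

end

theory Submission
  imports Defs
begin

text \<open>
  Write \<open>f\<^sub>z(x) = cos (d(x, z))\<close>. By comparison these functions satisfy \<open>f'' + f \<le> 0\<close> along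
  geodesics, in midpoint form \<open>f(x) + f(y) \<le> 2 cos (d(x, y) / 2) f(m)\<close>, so maximizing sequences
  of infima or nonnegative combinations of them are Cauchy. If the radius is less than \<open>pi / 2\<close>,
  the circumcenter is the unique maximum point of \<open>inf\<^sub>z f\<^sub>z\<close>.

  The dimension enters as follows: in finite dimension there are a finite set \<open>P\<close> and \<open>\<eta> > 0\<close> such
  that no point whose distances are all at most \<open>pi / 2 + \<eta>\<close> is at distance at least
  \<open>pi / 2 - \<eta>\<close> from every point of \<open>P\<close>. Otherwise one chooses inductively arbitrarily many points
  \<open>x\<^sub>i\<close> that are almost orthonormal in the sense of an approximate Bessel inequality
  \<open>\<Sum>\<^sub>i max (0, f\<^sub>i)\<^sup>2 \<le> 1 + e\<close> with \<open>f\<^sub>i = f\<^bsub>x_i\<^esub>\<close>. The maximum point \<open>\<sigma>(t)\<close> of \<open>\<Sum>\<^sub>i t\<^sub>i f\<^sub>i\<close> is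
  then a continuous singular simplex, \<open>t\<^sub>i = 0\<close> forces \<open>f\<^sub>i(\<sigma>(t))\<close> to be almost nonpositive, and
  the open sets \<open>f\<^sub>i > const\<close> cover its image; a refinement of small multiplicity contradicts
  the Poincare-Miranda theorem.

  For radius \<open>pi / 2\<close> this is used twice. First, almost circumcenters lie in a fixed ball
  of radius less than \<open>pi / 2\<close> about some \<open>p\<close>, and then maximizing \<open>f\<^sub>p\<close> over the convex sets
  \<open>f\<^sub>z + a f\<^sub>p \<ge> 0\<close> and letting \<open>a\<close> tend to \<open>0\<close> yields a circumcenter. Second, the set \<open>C\<close> of all
  circumcenters is convex of diameter at most \<open>pi / 2\<close>, and an iterated midpoint of the
  finite set \<open>P \<subseteq> C\<close> shows that \<open>C\<close> has radius less than \<open>pi / 2\<close>; the unique circumcenter of \<open>C\<close> is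
  the required fixed point.
\<close>

section \<open>Comparison inequality for the cosine of the distance\<close>

definition cosd :: "'a::metric_space \<Rightarrow> 'a \<Rightarrow> real" where
  "cosd z x = cos (dist x z)"

text \<open>The great circle arc is given by spherical linear interpolation. The formula is
  multiplied by \<open>sin (sphere_dist u w)\<close> so that it also covers coinciding
  endpoints.\<close>

lemma sphere_geodesic_exists:
  assumes "norm u = 1" "norm w = 1" "sphere_dist u w < pi"
  shows "\<exists>c. geodesic sphere_dist S2 u w c \<and>
    (\<forall>s. sin (sphere_dist u w) *\<^sub>R c s = sin (sphere_dist u w - s) *\<^sub>R u + sin s *\<^sub>R w)"
proof -
  define l where "l = sphere_dist u w"
  have bd: "\<bar>u \<bullet> w\<bar> \<le> 1"
    using Cauchy_Schwarz_ineq2[of u w] assms by simp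
  have l0: "0 \<le> l" "l < pi" and cl: "cos l = u \<bullet> w"
    using assms bd by (auto simp: l_def sphere_dist_def arccos_lbound)
  have uu: "u \<bullet> u = 1" and ww: "w \<bullet> w = 1"
    using assms by (auto simp: norm_eq_1)
  show ?thesis
  proof (cases "l = 0")
    case True
    then have "u \<bullet> w = 1" using cl by simp
    then have "u = w" using uu ww
      by (metis assms(1,2) norm_cauchy_schwarz_eq mult_1 scaleR_one)
    then have "geodesic sphere_dist S2 u w (\<lambda>_. u)" using True assms uu
      by (auto simp: geodesic_def l_def[symmetric]) (auto simp: sphere_dist_def)
    moreover have "sin l *\<^sub>R u = sin (l - s) *\<^sub>R u + sin s *\<^sub>R w" for s
      using True \<open>u = w\<close> by (simp flip: scaleR_left_distrib)
    ultimately show ?thesis unfolding l_def by blast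
  next
    case False
    then have sl: "sin l > 0" using l0 by (simp add: sin_gt_zero)
    define c where "c = (\<lambda>s. (1 / sin l) *\<^sub>R (sin (l - s) *\<^sub>R u + sin s *\<^sub>R w))"
    have ip: "c s \<bullet> c t = cos (s - t)" for s t
    proof -
      have "(sin l)\<^sup>2 * (c s \<bullet> c t) =
         sin (l-s) * sin (l-t) + (sin (l-s) * sin t + sin s * sin (l-t)) * cos l + sin s * sin t"
        using sl by (simp add: c_def inner_add_left inner_add_right uu ww cl inner_commute[of w u]
            field_simps power2_eq_square)
      also have "\<dots> = (sin l)\<^sup>2 * cos (s - t)"
        unfolding sin_diff cos_diff using sin_cos_squared_add[of l]  by algebra
      finally show ?thesis using sl by simp
    qed
    have "geodesic sphere_dist S2 u w c"
      unfolding geodesic_def l_def[symmetric]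
    proof (intro conjI ballI)
      show "c 0 = u" "c l = w" using sl by (auto simp: c_def)
      show "c ` {0..l} \<subseteq> S2" using ip by (auto simp: norm_eq_1)
      fix s t assume "s \<in> {0..l}" "t \<in> {0..l}"
      then have "\<bar>s - t\<bar> \<le> pi" using l0 by auto
      then show "sphere_dist (c s) (c t) = \<bar>s - t\<bar>"
        using arccos_cos[of "\<bar>s - t\<bar>"] by (simp add: sphere_dist_def ip)
    qed
    moreover have "sin l *\<^sub>R c s = sin (l - s) *\<^sub>R u + sin s *\<^sub>R w" for s
      using sl by (simp add: c_def)
    ultimately show ?thesis unfolding l_def by blast
  qed
qed

text \<open>Place \<open>x\<close> and \<open>y\<close> in a coordinate plane; the spherical law of
  cosines dictates the second coordinate \<open>h\<close> of \<open>z\<close>. The triangle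
  inequalities and the perimeter bound give \<open>\<bar>h\<bar> \<le> sin a\<close>, so the third
  coordinate exists.\<close>

lemma comparison_points_exist:
  fixes a b l :: real
  assumes "0 < l" "l < pi" "\<bar>a - b\<bar> \<le> l" "l \<le> a + b" "a + b + l < 2 * pi"
  obtains x y z :: "real^3" where "norm x = 1" "norm y = 1" "norm z = 1"
    "sphere_dist x y = l" "sphere_dist x z = a" "sphere_dist y z = b"
proof -
  have ab: "0 \<le> a" "a \<le> pi" "0 \<le> b" "b \<le> pi" using assms by auto
  have sl: "sin l > 0" using assms by (simp add: sin_gt_zero)
  define h where "h = (cos b - cos l * cos a) / sin l"
  have hs: "sin l * h = cos b - cos l * cos a" using sl by (simp add: h_def)
  have 1: "cos b \<le> cos (l - a)"
  proof -
    have "cos (l - a) = cos \<bar>l - a\<bar>" by (metis abs_if cos_minus)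
    then show ?thesis using assms ab cos_monotone_0_pi_le[of "\<bar>l - a\<bar>" b] by auto
  qed
  have 2: "cos (l + a) \<le> cos b"
  proof (cases "l + a \<le> pi")
    case True then show ?thesis using assms ab by (intro cos_monotone_0_pi_le) auto
  next
    case False
    have "cos (l + a) = cos (2 * pi - (l + a))" by (simp add: cos_diff)
    also have "\<dots> \<le> cos b" using assms ab False by (intro cos_monotone_0_pi_le) auto
    finally show ?thesis .
  qed
  have sa: "0 \<le> sin a" using ab by (simp add: sin_ge_zero)
  have "h \<le> sin a" "- sin a \<le> h"
    using 1 2 hs mult_le_cancel_left_pos[OF sl, of h "sin a"] mult_le_cancel_left_pos[OF sl, of "- sin a" h]
    by (auto simp: cos_diff cos_add)
  then have "\<bar>h\<bar> \<le> \<bar>sin a\<bar>" by auto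
  then have h2: "h\<^sup>2 \<le> (sin a)\<^sup>2" using abs_le_square_iff by blast
  define k where "k = sqrt ((sin a)\<^sup>2 - h\<^sup>2)"
  have k2: "k * k = (sin a)\<^sup>2 - h * h" using h2 by (simp add: k_def power2_eq_square[symmetric])
  define x y z :: "real^3" where "x = vector [1,0,0]" and "y = vector [cos l, sin l, 0]"
    and "z = vector [cos a, h, k]"
  have "x \<bullet> x = 1" by (simp add: x_def inner_vec_def sum_3)
  moreover have "y \<bullet> y = 1" by (simp add: y_def inner_vec_def sum_3 power2_eq_square[symmetric])
  moreover have "z \<bullet> z = 1"
    using k2 sin_cos_squared_add[of a] by (simp add: z_def inner_vec_def sum_3 power2_eq_square)
  ultimately have "norm x = 1" "norm y = 1" "norm z = 1" by (auto simp: norm_eq_1)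
  moreover have "x \<bullet> y = cos l" "x \<bullet> z = cos a" by (auto simp: x_def y_def z_def inner_vec_def sum_3)
  moreover have "y \<bullet> z = cos b" using hs by (simp add: y_def z_def inner_vec_def sum_3)
  ultimately show ?thesis using that[of x y z] ab assms by (auto simp: sphere_dist_def arccos_cos)
qed

text \<open>On the sphere, the inner product with a fixed vector is sinusoidal along a great circle,
  so the comparison triangle satisfies this with equality. The distance from \<open>z\<close> to
  \<open>c s\<close> is at most the spherical one, so its cosine is at least as large.\<close>

lemma CAT1_cos_comparison:
  assumes cat: "CAT1 X" and X: "x \<in> X" "y \<in> X" "z \<in> X"
    and per: "dist x y + dist x z + dist y z < 2 * pi"
    and geo: "geodesic dist X x y c" and s: "0 \<le> s" "s \<le> dist x y"
  shows "sin (dist x y - s) * cosd z x + sin s * cosd z y \<le> sin (dist x y) * cosd z (c s)"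
proof (cases "x = y")
  case True
  then show ?thesis using s by simp
next
  case False
  define l a b where "l = dist x y" and "a = dist x z" and "b = dist y z"
  have tri: "\<bar>a - b\<bar> \<le> l" "l \<le> a + b" "0 < l" "a + b + l < 2 * pi"
    using dist_triangle[of x z y] dist_triangle[of y z x] dist_triangle[of x y z] False per
    by (auto simp: l_def a_def b_def dist_commute)
  have lt: "l < pi" "a < pi" "b < pi" using tri by auto
  obtain c1 c2 where c1: "geodesic dist X y z c1" and c2: "geodesic dist X z x c2"
    using cat X lt by (force simp: CAT1_def a_def b_def dist_commute)
  obtain x' y' z' :: "real^3" where n: "norm x' = 1" "norm y' = 1" "norm z' = 1" and
    d: "sphere_dist x' y' = l" "sphere_dist x' z' = a" "sphere_dist y' z' = b"
    using comparison_points_exist[of l a b] tri lt by metis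
  have dzx: "sphere_dist z' x' = a" using d by (simp add: sphere_dist_def inner_commute)
  obtain e0 where e0: "geodesic sphere_dist S2 x' y' e0" and
    e0s: "\<And>s. sin l *\<^sub>R e0 s = sin (l - s) *\<^sub>R x' + sin s *\<^sub>R y'"
    using sphere_geodesic_exists[of x' y'] n d lt by auto
  obtain e1 where e1: "geodesic sphere_dist S2 y' z' e1"
    using sphere_geodesic_exists[of y' z'] n d lt by auto
  obtain e2 where e2: "geodesic sphere_dist S2 z' x' e2"
    using sphere_geodesic_exists[of z' x'] n dzx lt by auto
  define v where "v = (\<lambda>i::3. if i = 1 then x else if i = 2 then y else z)"
  define \<gamma> where "\<gamma> = (\<lambda>i::3. if i = 1 then c else if i = 2 then c1 else c2)"
  define v' where "v' = (\<lambda>i::3. if i = 1 then x' else if i = 2 then y' else z')"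
  define \<gamma>' where "\<gamma>' = (\<lambda>i::3. if i = 1 then e0 else if i = 2 then e1 else e2)"
  have "geodesic_triangle dist X v \<gamma>"
    unfolding geodesic_triangle_def forall_3 using geo c1 c2 by (simp add: v_def \<gamma>_def)
  moreover have "perimeter dist v < 2 * pi"
    using per by (simp add: perimeter_def sum_3 v_def dist_commute)
  ultimately have "not_thicker_than_comparison v \<gamma>" using cat by (simp add: CAT1_def)
  moreover have "geodesic_triangle sphere_dist S2 v' \<gamma>'"
    unfolding geodesic_triangle_def forall_3 using e0 e1 e2 by (simp add: v'_def \<gamma>'_def)
  moreover have "\<forall>i. sphere_dist (v' i) (v' (i + 1)) = dist (v i) (v (i + 1))"
    unfolding forall_3 using d dzx by (simp add: v_def v'_def l_def a_def b_def dist_commute)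
  ultimately have *: "dist (\<gamma> i s) (\<gamma> j t) \<le> sphere_dist (\<gamma>' i s) (\<gamma>' j t)"
    if "s \<in> {0..dist (v i) (v (i + 1))}" "t \<in> {0..dist (v j) (v (j + 1))}" for i j s t
    using that unfolding not_thicker_than_comparison_def by blast
  \<comment> \<open>The vertex \<open>z\<close> is addressed as the point with parameter 0 on the
    side of index 3, which leads from \<open>z\<close> back to \<open>x\<close>.\<close>
  have "dist (\<gamma> 1 s) (\<gamma> 3 0) \<le> sphere_dist (\<gamma>' 1 s) (\<gamma>' 3 0)"
    using s by (intro *) (auto simp: v_def)
  moreover have "c2 0 = z" "e2 0 = z'" using c2 e2 by (auto simp: geodesic_def)
  ultimately have le: "dist (c s) z \<le> arccos (e0 s \<bullet> z')"
    by (simp add: \<gamma>_def \<gamma>'_def sphere_dist_def)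
  have "e0 s \<in> S2" using e0 s d unfolding geodesic_def l_def[symmetric] by fastforce
  then have "\<bar>e0 s \<bullet> z'\<bar> \<le> 1" using Cauchy_Schwarz_ineq2[of "e0 s" z'] n by simp
  then have "e0 s \<bullet> z' \<le> cos (dist (c s) z)"
    using le cos_monotone_0_pi_le[of "dist (c s) z" "arccos (e0 s \<bullet> z')"] arccos_ubound[of "e0 s \<bullet> z'"]
    by (simp add: abs_le_iff)
  then have "sin l * (e0 s \<bullet> z') \<le> sin l * cos (dist (c s) z)"
    using tri lt by (intro mult_left_mono sin_ge_zero) auto
  moreover have "sin l * (e0 s \<bullet> z') = sin (l - s) * (x' \<bullet> z') + sin s * (y' \<bullet> z')"
    using arg_cong[OF e0s[of s], of "\<lambda>q. q \<bullet> z'"] by (simp add: inner_add_left)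
  moreover have "x' \<bullet> z' = cos a" "y' \<bullet> z' = cos b"
    using d n Cauchy_Schwarz_ineq2[of x' z'] Cauchy_Schwarz_ineq2[of y' z']
    by (auto simp: sphere_dist_def)
  ultimately show ?thesis by (simp add: cosd_def l_def a_def b_def)
qed

lemma cosd_bounds: "\<bar>cosd z x\<bar> \<le> 1"
  by (simp add: cosd_def)

lemma cosd_mono: "0 \<le> r \<Longrightarrow> dist x z \<le> pi \<Longrightarrow> dist x z \<le> r \<Longrightarrow> r \<le> pi \<Longrightarrow> cos r \<le> cosd z x"
  by (simp add: cosd_def cos_monotone_0_pi_le)

lemma dist_le_of_cosd:
  assumes "dist x z \<le> pi" "0 \<le> r" "r \<le> pi" "cos r \<le> cosd z x"
  shows "dist x z \<le> r"
  using assms cos_mono_le_eq[of r "dist x z"] by (simp add: cosd_def)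

lemma tendsto_cosd:
  "(f \<longlongrightarrow> a) F \<Longrightarrow> ((\<lambda>x. cosd z (f x)) \<longlongrightarrow> cosd z a) F"
  unfolding cosd_def by (rule isCont_tendsto_compose[OF isCont_cos tendsto_dist[OF _ tendsto_const]])

text \<open>This is \<open>CAT1_cos_comparison\<close> at the middle of a geodesic, divided by
  \<open>sin h\<close> using \<open>sin (2 * h) = 2 * sin h * cos h\<close>.\<close>

lemma CAT1_midpoint:
  assumes cat: "CAT1 X" and X: "x \<in> X" "y \<in> X" and xy: "dist x y < pi"
  obtains m where "m \<in> X" "dist x m = dist x y / 2" "dist y m = dist x y / 2"
    "\<And>z. z \<in> X \<Longrightarrow> dist x y + dist x z + dist y z < 2 * pi \<Longrightarrow>
      cosd z x + cosd z y \<le> 2 * cos (dist x y / 2) * cosd z m"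
proof -
  obtain c where c: "geodesic dist X x y c" using cat X xy unfolding CAT1_def by blast
  define h where "h = dist x y / 2"
  have h: "0 \<le> h" "h < pi / 2" and dh: "dist x y = 2 * h" using xy by (auto simp: h_def)
  have g: "c 0 = x" "c (2 * h) = y" "c ` {0..2 * h} \<subseteq> X"
    "\<And>s t. s \<in> {0..2*h} \<Longrightarrow> t \<in> {0..2*h} \<Longrightarrow> dist (c s) (c t) = \<bar>s - t\<bar>"
    using c by (auto simp: geodesic_def dh)
  have "cosd z x + cosd z y \<le> 2 * cos h * cosd z (c h)"
    if "z \<in> X" "dist x y + dist x z + dist y z < 2 * pi" for z
  proof (cases "h = 0")
    case True
    then show ?thesis using g by simp
  next
    case False
    then have sh: "sin h > 0" using h by (intro sin_gt_zero) auto
    have "sin h * (cosd z x + cosd z y) \<le> sin (2 * h) * cosd z (c h)"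
      using CAT1_cos_comparison[OF cat X that c, of h] h by (simp add: dh algebra_simps)
    then have "sin h * (cosd z x + cosd z y) \<le> sin h * (2 * cos h * cosd z (c h))"
      unfolding sin_double by (simp only: mult_ac)
    then show ?thesis using sh by simp
  qed
  moreover have "c h \<in> X" using g h by auto
  moreover have "dist x (c h) = h" "dist y (c h) = h"
    using g(4)[of 0 h] g(4)[of "2*h" h] g(1,2) h by auto
  ultimately show ?thesis using that[of "c h"] unfolding h_def by blast
qed

section \<open>Convergence of maximizing sequences\<close>

text \<open>If two almost maximal points were far apart, the factor
  \<open>cos (dist x y / 2)\<close> would force the value at the midpoint above the supremum.
  Decreasing sets allow a constraint that varies with \<open>k\<close>: the suprema
  \<open>M k\<close> converge, so values on \<open>S k\<close> and on a later \<open>S l\<close>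
  stay comparable.\<close>

lemma Cauchy_near_maximizers:
  fixes S :: "nat \<Rightarrow> 'a::metric_space set" and g :: "'a \<Rightarrow> real"
  assumes dec: "decseq S" and c: "c > 0" "\<And>k. \<exists>y\<in>S k. c \<le> g y"
    and bd: "\<And>y. y \<in> S 0 \<Longrightarrow> g y \<le> B"
    and mid: "\<And>k x y. x \<in> S k \<Longrightarrow> y \<in> S k \<Longrightarrow> g x > 0 \<Longrightarrow> g y > 0 \<Longrightarrow>
      dist x y < pi \<and> (\<exists>m\<in>S k. g x + g y \<le> 2 * cos (dist x y / 2) * g m)"
  obtains y where "\<And>k. y k \<in> S k" "\<And>k. g (y k) > 0" "Cauchy y"
    "\<And>k x. x \<in> S k \<Longrightarrow> g x \<le> g (y k) + 1 / real (k + 1)"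
proof -
  define M where "M = (\<lambda>k. SUP y\<in>S k. g y)"
  have sub: "S l \<subseteq> S k" if "k \<le> l" for k l using dec that by (auto simp: decseq_def)
  have bdd: "bdd_above (g ` S k)" for k
    using bd sub[of 0 k] by (intro bdd_aboveI2[where M=B]) auto
  have ne: "S k \<noteq> {}" for k using c(2) by blast
  have gM: "g y \<le> M k" if "y \<in> S k" for y k
    unfolding M_def using bdd that by (intro cSUP_upper)
  have cM: "c \<le> M k" for k using c(2)[of k] gM by force
  have decM: "decseq M"
    unfolding decseq_def M_def
    by (intro allI impI cSUP_subset_mono ne bdd sub) auto
  then obtain L where L: "M \<longlonglongrightarrow> L" and LM: "\<And>k. L \<le> M k"
    using decseq_convergent[of M c] cM by blast
  \<comment> \<open>The bound \<open>c / 2\<close> keeps the values positive, as \<open>mid\<close>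
    requires; the bound \<open>1 / (k + 1)\<close> makes the sequence maximizing.\<close>
  have "\<exists>y\<in>S k. M k - min (c/2) (1 / real (k+1)) < g y" for k
    using less_cSUP_iff[OF ne bdd, of "M k - min (c/2) (1 / real (k+1))" k] c by (simp add: M_def)
  then obtain y where yS: "\<And>k. y k \<in> S k" and yM: "\<And>k. M k - min (c/2) (1 / real (k+1)) < g (y k)"
    by metis
  have ypos: "g (y k) > 0" for k
    using yM[of k] cM[of k] c by (smt (verit) field_sum_of_halves)
  \<comment> \<open>A lower bound for \<open>cos (dist (y k) (y l) / 2)\<close> that follows from
    the midpoint inequality and \<open>c \<le> M k\<close>; it tends to 1.\<close>
  define r where "r = (\<lambda>k. 1 - (M k - L + 2 / real (k+1)) / (2 * c))"
  have key: "dist (y k) (y l) < pi \<and> r k \<le> cos (dist (y k) (y l) / 2)" if "k \<le> l" for k l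
  proof -
    have yl: "y l \<in> S k" using yS sub[OF that] by auto
    define d where "d = dist (y k) (y l)"
    obtain m where d: "d < pi" and m: "m \<in> S k" "g (y k) + g (y l) \<le> 2 * cos (d / 2) * g m"
      using mid[OF yS yl ypos ypos] by (auto simp: d_def)
    have "cos (d / 2) > 0" using d by (intro cos_gt_zero_pi) (auto simp: d_def intro: less_le_trans[of _ 0])
    then have "cos (d / 2) * g m \<le> cos (d / 2) * M k" using gM[OF m(1)] by simp
    moreover have "M k - 1 / real (k+1) < g (y k)" using yM[of k] by linarith
    moreover have "L - 1 / real (k+1) < g (y l)"
    proof -
      have "1 / real (l+1) \<le> 1 / real (k+1)" using that by (simp add: frac_le)
      then show ?thesis using yM[of l] LM[of l] by linarith
    qed
    ultimately have "M k + L - 2 / real (k+1) \<le> 2 * (cos (d / 2) * M k)"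
      using m(2) by simp
    then have 1: "2 * M k * (1 - cos (d / 2)) \<le> M k - L + 2 / real (k+1)" by (simp add: algebra_simps)
    have "2 * c * (1 - cos (d / 2)) \<le> 2 * M k * (1 - cos (d / 2))"
      using cM[of k] by (intro mult_right_mono) auto
    with 1 have "2 * c * (1 - cos (d / 2)) \<le> M k - L + 2 / real (k+1)" by linarith
    then have "1 - cos (d / 2) \<le> (M k - L + 2 / real (k+1)) / (2 * c)"
      using c(1) by (simp add: pos_le_divide_eq mult.commute)
    then show ?thesis using d by (simp add: r_def d_def)
  qed
  have "r \<longlonglongrightarrow> 1 - (L - L + 0) / (2 * c)"
    unfolding r_def
    by (intro tendsto_intros L LIMSEQ_Suc[OF lim_const_over_n, simplified Suc_eq_plus1]) (use c in auto)
  then have rlim: "r \<longlonglongrightarrow> 1" by simp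
  have "Cauchy y"
  proof (rule metric_CauchyI)
    fix e :: real assume e: "e > 0"
    define e' where "e' = min e pi"
    have e': "0 < e'" "e' \<le> pi" "e' \<le> e" using e by (auto simp: e'_def)
    have "cos (e' / 2) < 1" using cos_monotone_0_pi[of 0 "e'/2"] e' by simp
    then obtain N where N: "\<And>k. k \<ge> N \<Longrightarrow> cos (e' / 2) < r k"
      using order_tendstoD(1)[OF rlim] unfolding eventually_sequentially by blast
    have le: "dist (y k) (y l) < e" if "N \<le> k" "k \<le> l" for k l
    proof (rule ccontr)
      assume "\<not> dist (y k) (y l) < e"
      then have "cos (dist (y k) (y l) / 2) \<le> cos (e' / 2)"
        using key[OF that(2)] e' by (intro cos_monotone_0_pi_le) auto
      then show False using N[OF that(1)] key[OF that(2)] by simp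
    qed
    show "\<exists>N. \<forall>m\<ge>N. \<forall>n\<ge>N. dist (y m) (y n) < e"
    proof (intro exI allI impI)
      fix m n assume "N \<le> m" "N \<le> n"
      then show "dist (y m) (y n) < e"
        using le[of m n] le[of n m] by (cases "m \<le> n") (auto simp: dist_commute)
    qed
  qed
  moreover have "g x \<le> g (y k) + 1 / real (k + 1)" if "x \<in> S k" for x k
    using gM[OF that] yM[of k] by linarith
  ultimately show ?thesis using that yS ypos by blast
qed

section \<open>The Poincare-Miranda theorem\<close>

text \<open>Indexing by all natural numbers lets the dimension be a variable; the cube stays compact
  as a product of compact intervals.\<close>

abbreviation unit_box :: "(nat \<Rightarrow> real) set" where
  "unit_box \<equiv> {u. \<forall>i. 0 \<le> u i \<and> u i \<le> 1}"

lemma compact_unit_box: "compact unit_box"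
proof -
  have "compactin (product_topology (\<lambda>i::nat. euclideanreal) UNIV) (PiE UNIV (\<lambda>i. {0..1}))"
    by (simp add: compactin_PiE)
  moreover have "PiE UNIV (\<lambda>i. {0..1::real}) = unit_box" by auto
  ultimately show ?thesis
    unfolding euclidean_product_topology compactin_euclidean_iff by simp
qed

lemma tendsto_fun_iff:
  fixes f :: "'b \<Rightarrow> 'i \<Rightarrow> 'c::topological_space"
  shows "(f \<longlongrightarrow> l) F \<longleftrightarrow> (\<forall>i. ((\<lambda>c. f c i) \<longlongrightarrow> l i) F)"
  using limitin_componentwise[of "\<lambda>_. euclidean" UNIV f l F]
  by (simp add: euclidean_product_topology limitin_canonical_iff)

text \<open>Kuhn's labelling lemma on the grid of mesh \<open>1 / p\<close> gives a cell on which
  every \<open>h i\<close> takes both weak signs. Along a subsequence the cells shrink to a point,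
  where by continuity all \<open>h i\<close> vanish.\<close>

lemma Poincare_Miranda:
  fixes h :: "nat \<Rightarrow> (nat \<Rightarrow> real) \<Rightarrow> real"
  assumes cont: "\<And>i. i < n \<Longrightarrow> continuous_on unit_box (h i)"
    and lo: "\<And>i u. i < n \<Longrightarrow> u \<in> unit_box \<Longrightarrow> u i = 0 \<Longrightarrow> h i u \<le> 0"
    and hi: "\<And>i u. i < n \<Longrightarrow> u \<in> unit_box \<Longrightarrow> u i = 1 \<Longrightarrow> 0 \<le> h i u"
  obtains u where "u \<in> unit_box" "\<And>i. i < n \<Longrightarrow> h i u = 0"
proof -
  define pt where "pt = (\<lambda>p x i. if i < n then real (x i) / real p else (0::real))"
  have pt_box: "pt p x \<in> unit_box" if "p > 0" "\<forall>i<n. x i \<le> p" for p x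
    using that by (auto simp: pt_def)
  \<comment> \<open>The label records the sign of \<open>h i\<close>, but is forced to 0 and 1 on
    the two opposite faces as Kuhn's lemma demands; by \<open>lo\<close> and \<open>hi\<close> it
    still tells a weak sign there.\<close>
  define lab where "lab = (\<lambda>p x i. if x i = p \<or> (x i \<noteq> 0 \<and> h i (pt p x) > 0) then 1 else (0::nat))"
  define cell where "cell = (\<lambda>q r. \<forall>j<n. q j \<le> r j \<and> r j \<le> q j + (1::nat))"
  have "\<exists>q. (\<forall>i<n. q i < p) \<and>
      (\<forall>i<n. \<exists>r s. cell q r \<and> cell q s \<and> h i (pt p r) \<le> 0 \<and> 0 \<le> h i (pt p s))"
    if p: "p > 0" for p
  proof -
    have lab: "\<forall>x. (\<forall>i<n. x i \<le> p) \<longrightarrow> (\<forall>i<n. lab p x i = 0 \<or> lab p x i = 1)"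
      "\<forall>x. (\<forall>i<n. x i \<le> p) \<longrightarrow> (\<forall>i<n. x i = 0 \<longrightarrow> lab p x i = 0)"
      "\<forall>x. (\<forall>i<n. x i \<le> p) \<longrightarrow> (\<forall>i<n. x i = p \<longrightarrow> lab p x i = 1)"
      using p by (auto simp: lab_def)
    obtain q where q: "\<forall>i<n. q i < p" and qrs: "\<forall>i<n. \<exists>r s. (\<forall>j<n. q j \<le> r j \<and> r j \<le> q j + 1) \<and>
        (\<forall>j<n. q j \<le> s j \<and> s j \<le> q j + 1) \<and> lab p r i \<noteq> lab p s i"
      by (rule kuhn_lemma[OF p lab])
    have "\<exists>r s. cell q r \<and> cell q s \<and> h i (pt p r) \<le> 0 \<and> 0 \<le> h i (pt p s)" if i: "i < n" for i
    proof -
      have box: "pt p r \<in> unit_box" if "cell q r" for r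
        using that q p by (intro pt_box) (auto simp: cell_def Suc_le_eq intro: le_trans)
      have neg: "h i (pt p r) \<le> 0" if "cell q r" "lab p r i = 0" for r
        using lo[OF i box[OF that(1)]] that(2) i by (auto simp: lab_def pt_def split: if_splits)
      have pos: "0 \<le> h i (pt p r)" if "cell q r" "lab p r i = 1" for r
        using hi[OF i box[OF that(1)]] that(2) i p by (auto simp: lab_def pt_def split: if_splits)
      obtain r s where rs: "cell q r" "cell q s" "lab p r i \<noteq> lab p s i"
        using qrs i unfolding cell_def by blast
      then consider "lab p r i = 0" "lab p s i = 1" | "lab p r i = 1" "lab p s i = 0"
        by (auto simp: lab_def split: if_splits)
      then show ?thesis using rs neg pos by cases blast+
    qed
    then show ?thesis using q by blast
  qed
  then obtain q where q: "\<And>p i. p > 0 \<Longrightarrow> i < n \<Longrightarrow> q p i < p" and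
    "\<And>p i. p > 0 \<Longrightarrow> i < n \<Longrightarrow>
      \<exists>r s. cell (q p) r \<and> cell (q p) s \<and> h i (pt p r) \<le> 0 \<and> 0 \<le> h i (pt p s)"
    by metis
  then obtain R T where R: "\<And>p i. p > 0 \<Longrightarrow> i < n \<Longrightarrow> cell (q p) (R p i) \<and> h i (pt p (R p i)) \<le> 0"
    and T: "\<And>p i. p > 0 \<Longrightarrow> i < n \<Longrightarrow> cell (q p) (T p i) \<and> 0 \<le> h i (pt p (T p i))"
    by metis
  have cell_box: "pt (Suc m) r \<in> unit_box" if "cell (q (Suc m)) r" for m r
    using that q[of "Suc m"] by (intro pt_box) (force simp: cell_def)+
  define z where "z = (\<lambda>k. pt (Suc k) (q (Suc k)))"
  have zb: "\<forall>k. z k \<in> unit_box"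
    unfolding z_def using q by (intro allI pt_box) (auto intro: less_imp_le)
  obtain u \<phi> where u: "u \<in> unit_box" and \<phi>: "strict_mono \<phi>" and lim: "(z \<circ> \<phi>) \<longlonglongrightarrow> u"
    by (rule seq_compactE[OF compact_imp_seq_compact[OF compact_unit_box] zb])
  \<comment> \<open>Vertices of a cell differ from its base corner by at most \<open>1 / p\<close>
    in each coordinate, so any choice of them has the same limit.\<close>
  have near: "(\<lambda>k. pt (Suc (\<phi> k)) (V (Suc (\<phi> k)))) \<longlonglongrightarrow> u"
    if V: "\<And>p. p > 0 \<Longrightarrow> cell (q p) (V p)" for V
  proof (rule tendsto_fun_iff[THEN iffD2], rule allI)
    fix j
    have zj: "(\<lambda>k. z (\<phi> k) j) \<longlonglongrightarrow> u j"
      using tendsto_fun_iff[THEN iffD1, OF lim] by (simp add: o_def)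
    have "(\<lambda>k. inverse (real (Suc (\<phi> k)))) \<longlonglongrightarrow> 0"
      using LIMSEQ_subseq_LIMSEQ[OF LIMSEQ_inverse_real_of_nat \<phi>] by (simp add: o_def)
    from tendsto_add[OF zj this] have zj': "(\<lambda>k. z (\<phi> k) j + inverse (real (Suc (\<phi> k)))) \<longlonglongrightarrow> u j" by simp
    have "z (\<phi> k) j \<le> pt (Suc (\<phi> k)) (V (Suc (\<phi> k))) j \<and>
        pt (Suc (\<phi> k)) (V (Suc (\<phi> k))) j \<le> z (\<phi> k) j + inverse (real (Suc (\<phi> k)))" for k
    proof (cases "j < n")
      case True
      then have "real (q (Suc (\<phi> k)) j) \<le> V (Suc (\<phi> k)) j" "real (V (Suc (\<phi> k)) j) \<le> q (Suc (\<phi> k)) j + 1"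
        using V[of "Suc (\<phi> k)"] by (auto simp: cell_def simp flip: of_nat_Suc)
      then have "real (q (Suc (\<phi> k)) j) / real (Suc (\<phi> k)) \<le> V (Suc (\<phi> k)) j / real (Suc (\<phi> k))"
        "V (Suc (\<phi> k)) j / real (Suc (\<phi> k)) \<le> (real (q (Suc (\<phi> k)) j) + 1) / real (Suc (\<phi> k))"
        by (intro divide_right_mono; simp)+
      then show ?thesis using True by (simp add: z_def pt_def add_divide_distrib inverse_eq_divide)
    qed (simp add: z_def pt_def)
    then show "(\<lambda>k. pt (Suc (\<phi> k)) (V (Suc (\<phi> k))) j) \<longlonglongrightarrow> u j"
      by (intro tendsto_sandwich[OF _ _ zj zj']) auto
  qed
  have "h i u = 0" if i: "i < n" for i
  proof -
    have hlim: "(\<lambda>k. h i (pt (Suc (\<phi> k)) (V (Suc (\<phi> k))))) \<longlonglongrightarrow> h i u"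
      if V: "\<And>p. p > 0 \<Longrightarrow> cell (q p) (V p)" for V
    proof (rule continuous_on_tendsto_compose[OF cont[OF i] near u])
      show "\<forall>\<^sub>F k in sequentially. pt (Suc (\<phi> k)) (V (Suc (\<phi> k))) \<in> unit_box"
        using V by (intro always_eventually allI cell_box) simp
    qed (use V in auto)
    have "h i u \<le> 0" using R i by (intro LIMSEQ_le_const2[OF hlim[of "\<lambda>p. R p i"]]) auto
    moreover have "0 \<le> h i u" using T i by (intro LIMSEQ_le_const[OF hlim[of "\<lambda>p. T p i"]]) auto
    ultimately show ?thesis by simp
  qed
  then show ?thesis using that u by blast
qed

section \<open>Almost orthonormal points\<close>

text \<open>This is \<open>sin s \<le> s\<close> at \<open>s = pi / 2 - dist y z\<close>: a lower
  bound on the cosine becomes a linear gap below a right angle.\<close>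

lemma dist_le_half_pi_minus_cosd:
  assumes "dist y z \<le> pi" "0 \<le> cosd z y"
  shows "dist y z \<le> pi / 2 - cosd z y"
proof (cases "dist y z \<le> pi / 2")
  case True
  then have "sin (pi / 2 - dist y z) \<le> pi / 2 - dist y z" by (intro sin_x_le_x) simp
  then show ?thesis by (simp add: cosd_def sin_diff)
next
  case False
  then have "cos (dist y z) < cos (pi / 2)" using assms by (intro cos_monotone_0_pi) auto
  then show ?thesis using assms by (simp add: cosd_def)
qed

text \<open>Equality holds at \<open>s = 0\<close>, so the derivative \<open>b - cos L * a\<close>
  of the left side there is nonpositive. Instead of differentiating, the proof divides by
  \<open>2 * sin (s / 2)\<close> and lets \<open>s\<close> tend to 0.\<close>

lemma first_variation_real:
  fixes a b L :: real
  assumes "0 < L" "L < pi"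
    and le: "\<And>s. 0 \<le> s \<Longrightarrow> s \<le> L \<Longrightarrow> sin (L - s) * a + sin s * b \<le> sin L * a"
  shows "b \<le> cos L * a"
proof -
  have *: "cos (s / 2) * b \<le> cos (L - s / 2) * a" if s: "0 < s" "s \<le> L" for s
  proof -
    have "0 < sin (s / 2)" using s assms by (intro sin_gt_zero) auto
    moreover have "sin L - sin (L - s) = 2 * sin (s / 2) * cos (L - s / 2)"
      by (simp add: sin_diff_sin diff_divide_distrib)
    moreover have "sin s = 2 * sin (s / 2) * cos (s / 2)" using sin_double[of "s / 2"] by simp
    moreover have "sin s * b \<le> (sin L - sin (L - s)) * a" using le[of s] s by (simp add: algebra_simps)
    ultimately have "(2 * sin (s / 2)) * (cos (s / 2) * b) \<le> (2 * sin (s / 2)) * (cos (L - s / 2) * a)"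
      by (simp add: mult.assoc)
    then show ?thesis using \<open>0 < sin (s / 2)\<close> by simp
  qed
  define s where "s = (\<lambda>k. L * inverse (real (Suc k)))"
  have s: "0 < s k \<and> s k \<le> L" for k
    using assms(1) by (simp add: s_def field_simps)
  have "s \<longlonglongrightarrow> L * 0" unfolding s_def by (intro tendsto_intros LIMSEQ_inverse_real_of_nat)
  then have s0: "s \<longlonglongrightarrow> 0" by simp
  have "(\<lambda>k. cos (s k / 2) * b) \<longlonglongrightarrow> cos (0 / 2) * b"
    "(\<lambda>k. cos (L - s k / 2) * a) \<longlonglongrightarrow> cos (L - 0 / 2) * a"
    by (intro tendsto_intros s0; simp)+
  then show ?thesis using LIMSEQ_le[of "\<lambda>k. cos (s k / 2) * b" "cos (0 / 2) * b"] * s by fastforce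
qed

text \<open>The model is an orthonormal basis in the part of the unit sphere with nonnegative
  coordinates, where \<open>center\<close> and \<open>Bessel\<close> hold with \<open>e = 0\<close>.
  The bound \<open>e_small\<close> keeps the accumulated error \<open>n * e\<close> below the gaps
  between the thresholds 1/2, 1/4 and 1/8.\<close>

locale near_orthonormal =
  fixes Y :: "'a::metric_space set" and x :: "nat \<Rightarrow> 'a" and n :: nat and e :: real
  assumes cat: "CAT1 Y"
    and xY: "\<And>i. i < n \<Longrightarrow> x i \<in> Y"
    and center: "\<And>i z. i < n \<Longrightarrow> z \<in> Y \<Longrightarrow> dist (x i) z \<le> pi / 2 + e"
    and Bessel: "\<And>z. z \<in> Y \<Longrightarrow> (\<Sum>i<n. (max 0 (cosd (x i) z))\<^sup>2) \<le> 1 + e"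
    and e_pos: "0 < e" and e_small: "32 * (real n + 1) * e \<le> 1"
begin

definition g :: "(nat \<Rightarrow> real) \<Rightarrow> 'a \<Rightarrow> real" where
  "g t z = (\<Sum>i<n. t i * cosd (x i) z)"

text \<open>Parameters are not normalized: only the direction of \<open>t\<close> matters for the maximum point of \<open>g t\<close>.\<close>

definition params :: "(nat \<Rightarrow> real) set" where
  "params = unit_box \<inter> (\<Union>j<n. {t. 1/2 \<le> t j})"

lemma e_bounds: "real n * e \<le> 1/32" "e \<le> 1/32" "e \<le> 1"
proof -
  have "32 * (real n * e) + 32 * e \<le> 1" using e_small by (simp add: algebra_simps)
  moreover have "0 \<le> real n * e" using e_pos by simp
  ultimately show "real n * e \<le> 1/32" "e \<le> 1/32" "e \<le> 1" using e_pos by linarith+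
qed

lemma params_bounds: "t \<in> params \<Longrightarrow> 0 \<le> t i" "t \<in> params \<Longrightarrow> t i \<le> 1"
  by (auto simp: params_def)

lemma n_pos: "t \<in> params \<Longrightarrow> 0 < n"
  by (auto simp: params_def)

lemma f_lower:
  assumes "i < n" "z \<in> Y" shows "- e \<le> cosd (x i) z"
proof -
  have "- e \<le> - sin e" using e_pos by (simp add: sin_x_le_x)
  also have "\<dots> = cos (pi / 2 + e)" by (simp add: cos_add)
  also have "\<dots> \<le> cosd (x i) z"
    using center[OF assms] e_bounds e_pos pi_gt3 by (intro cosd_mono) (auto simp: dist_commute)
  finally show ?thesis .
qed

lemma g_at_x:
  assumes t: "t \<in> params" and j: "j < n"
  shows "t j - real n * e \<le> g t (x j)"
proof -
  have "- (real n * e) \<le> (\<Sum>i\<in>{..<n} - {j}. - e)" using e_pos j by (simp add: algebra_simps)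
  also have "\<dots> \<le> (\<Sum>i\<in>{..<n} - {j}. t i * cosd (x i) (x j))"
  proof (rule sum_mono)
    fix i assume "i \<in> {..<n} - {j}"
    then have "- e \<le> cosd (x i) (x j)" using f_lower xY j by auto
    then have "t i * (- e) \<le> t i * cosd (x i) (x j)"
      using params_bounds[OF t] by (intro mult_left_mono) auto
    moreover have "t i * e \<le> 1 * e" using params_bounds[OF t] e_pos by (intro mult_right_mono) auto
    ultimately show "- e \<le> t i * cosd (x i) (x j)" by simp
  qed
  finally show ?thesis
    using j by (simp add: g_def sum.remove[of "{..<n}" j] cosd_def)
qed

lemma g_le_n:
  assumes t: "t \<in> params" shows "g t z \<le> real n"
proof -
  have "g t z \<le> (\<Sum>i<n. 1 * 1)" unfolding g_def
  proof (rule sum_mono)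
    fix i
    have "t i * cosd (x i) z \<le> t i * 1"
      using cosd_bounds[of "x i" z] params_bounds[OF t] by (intro mult_left_mono) auto
    then show "t i * cosd (x i) z \<le> 1 * 1" using params_bounds(2)[OF t, of i] by simp
  qed
  then show ?thesis by simp
qed

text \<open>Some \<open>cosd (x i) y\<close> is at least \<open>1 / (8 * n)\<close>, hence at least
  \<open>4 * e\<close>, so \<open>y\<close> is within \<open>pi / 2 - 4 * e\<close> of
  \<open>x i\<close>, while all points are within \<open>pi / 2 + e\<close> of it. The resulting
  slack \<open>3 * e\<close> brings triangles with vertex \<open>x k\<close> below the perimeter
  bound.\<close>

lemma pair:
  assumes t: "t \<in> params" and y: "y \<in> Y" "1/8 \<le> g t y" and z: "z \<in> Y"
  shows "dist y z < pi" "k < n \<Longrightarrow> dist y z + dist y (x k) + dist z (x k) < 2 * pi"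
proof -
  have n: "0 < n" using n_pos[OF t] .
  have "\<exists>i<n. 1 / (8 * n) \<le> t i * cosd (x i) y"
  proof (rule ccontr)
    assume "\<not> ?thesis"
    then have "g t y < (\<Sum>i<n. 1 / (8 * real n))"
      unfolding g_def using n by (intro sum_strict_mono) auto
    then show False using y n by simp
  qed
  then obtain i where i: "i < n" and fi: "1 / (8 * n) \<le> t i * cosd (x i) y" by blast
  have pos: "0 < t i * cosd (x i) y" using fi n by (intro less_le_trans[OF _ fi]) simp
  then have cp: "0 < cosd (x i) y" using params_bounds[OF t, of i] by (simp add: zero_less_mult_iff)
  then have "t i * cosd (x i) y \<le> 1 * cosd (x i) y"
    using params_bounds[OF t, of i] by (intro mult_right_mono) auto
  moreover have "4 * e \<le> 1 / (8 * n)" using e_bounds(1) n by (simp add: field_simps)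
  ultimately have "4 * e \<le> cosd (x i) y" using fi by linarith
  moreover have "dist y (x i) \<le> pi / 2 - cosd (x i) y"
    using center[OF i y(1)] cp e_bounds pi_gt3 by (intro dist_le_half_pi_minus_cosd) (auto simp: dist_commute)
  ultimately have *: "dist y z \<le> pi - 3 * e"
    using center[OF i z] dist_triangle[of y z "x i"] by (simp add: dist_commute)
  then show "dist y z < pi" using e_pos by linarith
  show "dist y z + dist y (x k) + dist z (x k) < 2 * pi" if "k < n"
    using * center[OF that y(1)] center[OF that z] e_pos by (simp add: dist_commute)
qed

text \<open>The midpoint inequalities are summed with the nonnegative weights \<open>t i\<close>.
  Since the cosine factor is at most 1, the midpoint stays above the threshold.\<close>

lemma midpoint_g:
  assumes t: "t \<in> params" and y: "y \<in> Y" "1/8 \<le> g t y" and z: "z \<in> Y" "1/8 \<le> g t z"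
  shows "\<exists>m\<in>Y. 1/8 \<le> g t m \<and> g t y + g t z \<le> 2 * cos (dist y z / 2) * g t m"
proof -
  obtain m where m: "m \<in> Y" "\<And>w. w \<in> Y \<Longrightarrow> dist y z + dist y w + dist z w < 2 * pi \<Longrightarrow>
      cosd w y + cosd w z \<le> 2 * cos (dist y z / 2) * cosd w m"
    using CAT1_midpoint[OF cat y(1) z(1) pair(1)[OF t y z(1)]] by metis
  have "g t y + g t z = (\<Sum>i<n. t i * (cosd (x i) y + cosd (x i) z))"
    by (simp add: g_def sum.distrib algebra_simps)
  also have "\<dots> \<le> (\<Sum>i<n. t i * (2 * cos (dist y z / 2) * cosd (x i) m))"
    using params_bounds[OF t] by (intro sum_mono mult_left_mono m(2) xY pair(2)[OF t y z(1)]) auto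
  also have "\<dots> = 2 * cos (dist y z / 2) * g t m"
    by (simp add: g_def sum_distrib_left mult_ac)
  finally have le: "g t y + g t z \<le> 2 * cos (dist y z / 2) * g t m" .
  have "1/8 \<le> g t m"
  proof -
    have 1: "1/8 \<le> cos (dist y z / 2) * g t m" using le y z by linarith
    have "- (pi / 2) < dist y z / 2"
      using zero_le_dist[of y z] pi_gt_zero by linarith
    then have "0 < cos (dist y z / 2)"
      using pair(1)[OF t y z(1)] by (intro cos_gt_zero_pi) auto
    with 1 have "0 \<le> g t m"
      by (smt (verit) mult_nonneg_nonpos divide_pos_pos)
    then have "cos (dist y z / 2) * g t m \<le> 1 * g t m" by (intro mult_right_mono) auto
    with 1 show ?thesis by simp
  qed
  then show ?thesis using m(1) le by blast
qed

lemma tendsto_g: "(h \<longlongrightarrow> p) F \<Longrightarrow> ((\<lambda>k. g t (h k)) \<longlongrightarrow> g t p) F"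
  unfolding g_def by (intro tendsto_sum tendsto_mult tendsto_const tendsto_cosd)

lemma maximizer_exists:
  assumes t: "t \<in> params"
  shows "\<exists>p\<in>Y. \<forall>z\<in>Y. g t z \<le> g t p"
proof -
  \<comment> \<open>The threshold is low enough for \<open>x j\<close> to lie in \<open>S\<close>
    and high enough for \<open>pair\<close> to apply; points outside \<open>S\<close> have a smaller
    value of \<open>g t\<close> than \<open>x j\<close>.\<close>
  define S where "S = {z\<in>Y. 1/8 \<le> g t z}"
  obtain j where j: "j < n" "1/2 \<le> t j" using t by (auto simp: params_def)
  have xj: "x j \<in> S" using g_at_x[OF t j(1)] e_bounds xY j by (simp add: S_def)
  obtain y where y: "\<And>k. y k \<in> S" "Cauchy y"
    "\<And>k z. z \<in> S \<Longrightarrow> g t z \<le> g t (y k) + 1 / real (k + 1)"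
  proof (rule Cauchy_near_maximizers[of "\<lambda>_. S" "1/8" "g t" "real n"])
    show "dist y z < pi \<and> (\<exists>m\<in>S. g t y + g t z \<le> 2 * cos (dist y z / 2) * g t m)"
      if "y \<in> S" "z \<in> S" for y z
      using that pair(1)[OF t, of y z] midpoint_g[OF t, of y z] by (auto simp: S_def)
  qed (use g_le_n[OF t] xj in \<open>auto simp: S_def decseq_def\<close>)
  have "complete Y" using cat by (simp add: CAT1_def)
  moreover have "\<forall>k. y k \<in> Y" using y(1) by (simp add: S_def)
  ultimately obtain p where p: "p \<in> Y" and lim: "y \<longlonglongrightarrow> p"
    using y(2) unfolding complete_def by metis
  have "g t z \<le> g t p" if "z \<in> S" for z
  proof -
    have "(\<lambda>k. g t (y k) + 1 / real (k + 1)) \<longlonglongrightarrow> g t p + 0"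
      by (intro tendsto_add tendsto_g lim LIMSEQ_Suc[OF lim_const_over_n, simplified Suc_eq_plus1])
    then show ?thesis using y(3)[OF that] by (intro LIMSEQ_le_const[of _ "g t p + 0", simplified]) auto
  qed
  moreover from this[OF xj] xj have "g t z \<le> g t p" if "z \<in> Y" "z \<notin> S" for z
    using that by (simp add: S_def)
  ultimately show ?thesis using p by blast
qed

section \<open>The singular simplex of maximum points\<close>

text \<open>In the orthonormal model this is \<open>t\<close> normalized, and \<open>G t\<close> is
  the norm of \<open>t\<close>. For \<open>t\<close> in \<open>params\<close> the choice is
  immaterial: by \<open>first_variation\<close> a second maximum point would be at distance
  0.\<close>

definition \<sigma> :: "(nat \<Rightarrow> real) \<Rightarrow> 'a" where
  "\<sigma> t = (SOME p. p \<in> Y \<and> (\<forall>z\<in>Y. g t z \<le> g t p))"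

definition G :: "(nat \<Rightarrow> real) \<Rightarrow> real" where
  "G t = g t (\<sigma> t)"

lemma
  assumes t: "t \<in> params"
  shows \<sigma>_in: "\<sigma> t \<in> Y" and G_max: "z \<in> Y \<Longrightarrow> g t z \<le> G t"
  using someI_ex[of "\<lambda>p. p \<in> Y \<and> (\<forall>z\<in>Y. g t z \<le> g t p)"] maximizer_exists[OF t]
  unfolding \<sigma>_def G_def by auto

lemma G_lower:
  assumes t: "t \<in> params" shows "1/4 \<le> G t"
proof -
  obtain j where j: "j < n" "1/2 \<le> t j" using t by (auto simp: params_def)
  then show ?thesis using G_max[OF t xY[OF j(1)]] g_at_x[OF t j(1)] e_bounds by linarith
qed

text \<open>The derivative of \<open>g t\<close> at its maximum point in the direction of \<open>z\<close> is nonpositive.\<close>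

lemma first_variation:
  assumes t: "t \<in> params" and z: "z \<in> Y"
  shows "g t z \<le> cos (dist (\<sigma> t) z) * G t"
proof (cases "\<sigma> t = z")
  case True
  then show ?thesis by (simp add: G_def)
next
  case False
  define L where "L = dist (\<sigma> t) z"
  have big: "1/8 \<le> g t (\<sigma> t)" using G_lower[OF t] by (simp add: G_def)
  have L: "0 < L" "L < pi" using False pair(1)[OF t \<sigma>_in[OF t] big z] by (auto simp: L_def)
  obtain c where c: "geodesic dist Y (\<sigma> t) z c"
    using cat L(2) z \<sigma>_in[OF t] unfolding CAT1_def L_def by blast
  have "g t z \<le> cos L * G t"
  proof (rule first_variation_real[OF L])
    fix s assume s: "0 \<le> s" "s \<le> L"
    have cs: "c s \<in> Y" using c s by (auto simp: geodesic_def L_def)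
    have "sin (L - s) * G t + sin s * g t z =
        (\<Sum>i<n. t i * (sin (L - s) * cosd (x i) (\<sigma> t) + sin s * cosd (x i) z))"
      by (simp add: g_def G_def sum.distrib sum_distrib_left algebra_simps)
    also have "\<dots> \<le> (\<Sum>i<n. t i * (sin L * cosd (x i) (c s)))"
      unfolding L_def
      using params_bounds[OF t] pair(2)[OF t \<sigma>_in[OF t] big z] s
      by (intro sum_mono mult_left_mono CAT1_cos_comparison[OF cat \<sigma>_in[OF t] z xY _ c])
        (auto simp: L_def)
    also have "\<dots> = sin L * g t (c s)" by (simp add: g_def sum_distrib_left mult_ac)
    also have "\<dots> \<le> sin L * G t"
      using G_max[OF t cs] L by (intro mult_left_mono sin_ge_zero) auto
    finally show "sin (L - s) * G t + sin s * g t z \<le> sin L * G t" .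
  qed
  then show ?thesis by (simp add: L_def)
qed

text \<open>The first variation is taken towards \<open>x j\<close>. In the model,
  \<open>cosd (x j) (\<sigma> t) * G t\<close> is exactly \<open>t j\<close>.\<close>

lemma \<sigma>_coord_lower:
  assumes t: "t \<in> params" and j: "j < n"
  shows "t j - real n * e \<le> cosd (x j) (\<sigma> t) * G t"
  using first_variation[OF t xY[OF j]] g_at_x[OF t j] by (simp add: cosd_def dist_commute)

lemma \<sigma>_large_coord:
  assumes t: "t \<in> params" and j: "j < n" "1/2 \<le> t j"
  shows "1 / (8 * real n) < cosd (x j) (\<sigma> t)"
proof -
  have le: "1/4 \<le> cosd (x j) (\<sigma> t) * G t"
    using \<sigma>_coord_lower[OF t j(1)] j(2) e_bounds by linarith
  then have "0 \<le> cosd (x j) (\<sigma> t)" using G_lower[OF t]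
    by (smt (verit) mult_nonpos_nonneg divide_pos_pos)
  moreover have "G t \<le> real n" using g_le_n[OF t] by (simp add: G_def)
  ultimately have "1/4 \<le> cosd (x j) (\<sigma> t) * real n"
    using le mult_left_mono by fastforce
  then show ?thesis using j(1) by (simp add: field_simps)
qed

text \<open>Two estimates of \<open>(G t)\<^sup>2\<close> are compared. The coordinate bounds give
  at least \<open>T - n\<^sup>2 * e\<close>; since \<open>t i = 0\<close>, Cauchy-Schwarz over the
  other coordinates and \<open>Bessel\<close> give at most
  \<open>T * (1 + e - (v i)\<^sup>2)\<close>. The factor 4 comes from
  \<open>1/4 \<le> T\<close>.\<close>

lemma \<sigma>_zero_coord:
  assumes t: "t \<in> params" and i: "i < n" "t i = 0"
  shows "(max 0 (cosd (x i) (\<sigma> t)))\<^sup>2 \<le> e + 4 * (real n)\<^sup>2 * e"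
proof -
  define v where "v = (\<lambda>k. max 0 (cosd (x k) (\<sigma> t)))"
  define T where "T = (\<Sum>k<n. (t k)\<^sup>2)"
  obtain j where j: "j < n" "1/2 \<le> t j" using t by (auto simp: params_def)
  have "(1/2)\<^sup>2 \<le> (t j)\<^sup>2" using j by (intro power_mono) auto
  also have "\<dots> \<le> T" unfolding T_def using j by (intro member_le_sum) auto
  finally have T: "1/4 \<le> T" by (simp add: power2_eq_square)
  have "T - (real n)\<^sup>2 * e \<le> (\<Sum>k<n. t k * (t k - real n * e))"
  proof -
    have "(\<Sum>k<n. t k * (real n * e)) \<le> (\<Sum>k<n. 1 * (real n * e))"
      using params_bounds[OF t] e_pos by (intro sum_mono mult_right_mono) auto
    then show ?thesis by (simp add: T_def algebra_simps sum_subtractf power2_eq_square)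
  qed
  also have "\<dots> \<le> (\<Sum>k<n. t k * (cosd (x k) (\<sigma> t) * G t))"
    using params_bounds[OF t] \<sigma>_coord_lower[OF t] by (intro sum_mono mult_left_mono) auto
  also have "\<dots> = (G t)\<^sup>2" by (simp add: G_def g_def power2_eq_square sum_distrib_right mult_ac)
  finally have lower: "T - (real n)\<^sup>2 * e \<le> (G t)\<^sup>2" .
  have "G t \<le> (\<Sum>k<n. t k * v k)"
    unfolding G_def g_def v_def using params_bounds[OF t] by (intro sum_mono mult_left_mono) auto
  also have "\<dots> = (\<Sum>k\<in>{..<n} - {i}. t k * v k)"
    using i by (simp add: sum.remove[of "{..<n}" i])
  finally have "(G t)\<^sup>2 \<le> (\<Sum>k\<in>{..<n} - {i}. t k * v k)\<^sup>2"
    using G_lower[OF t] by (intro power_mono) auto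
  also have "\<dots> \<le> (\<Sum>k\<in>{..<n} - {i}. (t k)\<^sup>2) * (\<Sum>k\<in>{..<n} - {i}. (v k)\<^sup>2)"
    by (rule Cauchy_Schwarz_ineq_sum)
  also have "(\<Sum>k\<in>{..<n} - {i}. (t k)\<^sup>2) = T"
    using i by (simp add: T_def sum.remove[of "{..<n}" i])
  also have "(\<Sum>k\<in>{..<n} - {i}. (v k)\<^sup>2) = (\<Sum>k<n. (v k)\<^sup>2) - (v i)\<^sup>2"
    using i by (simp add: sum.remove[of "{..<n}" i])
  also have "T * \<dots> \<le> T * (1 + e - (v i)\<^sup>2)"
    using Bessel[OF \<sigma>_in[OF t]] T by (intro mult_left_mono) (auto simp: v_def)
  finally have "T * (v i)\<^sup>2 \<le> T * e + (real n)\<^sup>2 * e" using lower by (simp add: algebra_simps)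
  also have "\<dots> \<le> T * (e + 4 * (real n)\<^sup>2 * e)"
  proof -
    have "1/4 * (4 * (real n)\<^sup>2 * e) \<le> T * (4 * (real n)\<^sup>2 * e)"
      using T e_pos by (intro mult_right_mono) auto
    then show ?thesis by (simp add: distrib_left)
  qed
  finally show ?thesis using T by (simp add: v_def)
qed

text \<open>For \<open>u\<close> near \<open>t\<close> the point \<open>\<sigma> u\<close> almost
  maximizes \<open>g t\<close>, as \<open>g u\<close> and \<open>g t\<close> differ uniformly by at
  most \<open>E u\<close>; by \<open>first_variation\<close> an almost maximum point is close to
  \<open>\<sigma> t\<close>.\<close>

lemma continuous_on_\<sigma>: "continuous_on params \<sigma>"
  unfolding continuous_on_def
proof (intro ballI tendstoI)
  fix t \<epsilon> assume t: "t \<in> params" and \<epsilon>: "(0::real) < \<epsilon>"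
  define r where "r = min \<epsilon> pi"
  have r: "0 < r" "r \<le> pi" "r \<le> \<epsilon>" using \<epsilon> by (auto simp: r_def)
  define E where "E = (\<lambda>u. \<Sum>i<n. \<bar>u i - t i\<bar>)"
  have "((\<lambda>u. u i) \<longlongrightarrow> t i) (at t within params)" for i
    using tendsto_ident_at[of t params] unfolding tendsto_fun_iff by blast
  then have "(E \<longlongrightarrow> (\<Sum>i<n. \<bar>t i - t i\<bar>)) (at t within params)"
    unfolding E_def by (intro tendsto_intros)
  then have "(E \<longlongrightarrow> 0) (at t within params)" by simp
  moreover have "0 < (1 - cos r) / 8" using cos_monotone_0_pi[of 0 r] r by simp
  ultimately have "\<forall>\<^sub>F u in at t within params. E u < (1 - cos r) / 8"
    by (rule order_tendstoD)
  moreover have "\<forall>\<^sub>F u in at t within params. u \<in> params"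
    by (simp add: eventually_at_filter)
  ultimately show "\<forall>\<^sub>F u in at t within params. dist (\<sigma> u) (\<sigma> t) < \<epsilon>"
  proof eventually_elim
    case (elim u)
    have diff: "\<bar>g u z - g t z\<bar> \<le> E u" for z
    proof -
      have "\<bar>g u z - g t z\<bar> = \<bar>\<Sum>i<n. (u i - t i) * cosd (x i) z\<bar>"
        by (simp add: g_def sum_subtractf left_diff_distrib)
      also have "\<dots> \<le> (\<Sum>i<n. \<bar>(u i - t i) * cosd (x i) z\<bar>)" by (rule sum_abs)
      also have "\<dots> \<le> E u" unfolding E_def
        using mult_left_mono[OF cosd_bounds abs_ge_zero] by (intro sum_mono) (simp add: abs_mult)
      finally show ?thesis .
    qed
    have Gt: "1/4 \<le> G t" using G_lower[OF t] .
    have su: "\<sigma> u \<in> Y" using \<sigma>_in elim by blast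
    have "G t - 2 * E u \<le> g t (\<sigma> u)"
      using G_max[OF elim(2) \<sigma>_in[OF t]] diff[of "\<sigma> t"] diff[of "\<sigma> u"] by (simp add: G_def abs_le_iff)
    also have "\<dots> \<le> cos (dist (\<sigma> t) (\<sigma> u)) * G t" using first_variation[OF t su] .
    finally have "(1 - cos (dist (\<sigma> t) (\<sigma> u))) * G t \<le> 2 * E u" by (simp add: algebra_simps)
    moreover have "(1 - cos (dist (\<sigma> t) (\<sigma> u))) * (1/4) \<le> (1 - cos (dist (\<sigma> t) (\<sigma> u))) * G t"
      using Gt by (intro mult_left_mono) auto
    ultimately have "1 - cos (dist (\<sigma> t) (\<sigma> u)) \<le> 8 * E u" by simp
    then have cc: "cos r < cos (dist (\<sigma> t) (\<sigma> u))" using elim(1) by simp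
    have "dist (\<sigma> t) (\<sigma> u) < pi"
      using pair(1)[OF t \<sigma>_in[OF t] _ su] Gt by (simp add: G_def)
    then have "dist (\<sigma> t) (\<sigma> u) < r"
      using cc r cos_mono_less_eq[of r "dist (\<sigma> t) (\<sigma> u)"] by simp
    then show ?case using r by (simp add: dist_commute)
  qed
qed

lemma compact_params: "compact params"
  unfolding params_def
  by (intro compact_Int_closed compact_unit_box closed_UN finite_lessThan ballI
      closed_Collect_le continuous_on_const continuous_on_product_coordinates)

lemma compact_\<sigma>_image: "compact (\<sigma> ` params)"
  by (rule compact_continuous_image[OF continuous_on_\<sigma> compact_params])

section \<open>Adjoining an almost orthogonal point\<close>

text \<open>The simplex stands for the span of the old points: a point \<open>y\<close> almost a
  right angle or more away from all of it serves as the next basis vector, with an error linear in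
  \<open>\<kappa>\<close> and \<open>e\<close>.\<close>

lemma Bessel_extend:
  assumes y: "y \<in> Y" and far: "\<And>q. q \<in> \<sigma> ` params \<Longrightarrow> pi / 2 - \<kappa> \<le> dist y q"
    and \<kappa>: "0 \<le> \<kappa>" "\<kappa> \<le> 1" and yc: "\<And>z. z \<in> Y \<Longrightarrow> dist y z \<le> pi" and z: "z \<in> Y"
  shows "(\<Sum>i<n. (max 0 (cosd (x i) z))\<^sup>2) + (max 0 (cosd y z))\<^sup>2 \<le> 1 + 3 * \<kappa> + 4 * e"
proof -
  define v where "v = (\<lambda>k. max 0 (cosd (x k) z))"
  define V where "V = (\<Sum>i<n. (v i)\<^sup>2)"
  define B where "B = dist z y"
  have V1: "V \<le> 1 + e" using Bessel[OF z] by (simp add: V_def v_def)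
  consider "cosd y z \<le> 0" | "\<forall>i<n. v i = 0" | j where "j < n" "v j > 0" "cosd y z > 0"
    by (metis linorder_not_less max.cobounded1 order_le_less v_def)
  then show ?thesis
  proof cases
    case 1
    then show ?thesis using V1 \<kappa> e_pos by (simp add: V_def v_def)
  next
    case 2
    have "(max 0 (cosd y z))\<^sup>2 \<le> 1\<^sup>2" using cosd_bounds[of y z] by (intro power_mono) auto
    then show ?thesis using 2 \<kappa> e_pos by (simp add: v_def)
  next
    case 3
    \<comment> \<open>The simplex point \<open>p\<close> in direction \<open>v\<close> acts as the projection of \<open>z\<close>: the part \<open>V\<close> of the
      Bessel sum is at most about \<open>(cos (dist p z))\<^sup>2\<close>, and \<open>dist p z + dist z y\<close> is almost \<open>pi / 2\<close> or more.\<close>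
    define \<mu> where "\<mu> = Max (v ` {..<n})"
    have fin: "finite (v ` {..<n})" "v ` {..<n} \<noteq> {}" using 3(1) by auto
    obtain j where j: "j < n" "v j = \<mu>" using Max_in[OF fin] by (auto simp: \<mu>_def)
    have le\<mu>: "v i \<le> \<mu>" if "i < n" for i unfolding \<mu>_def using that fin by (intro Max_ge) auto
    have \<mu>: "\<mu> > 0" using le\<mu>[OF 3(1)] 3(2) by simp
    define t where "t = (\<lambda>i. if i < n then v i / \<mu> else 0)"
    have t: "t \<in> params"
      unfolding params_def using le\<mu> \<mu> j by (auto simp: t_def v_def intro!: bexI[of _ j])
    define p where "p = \<sigma> t"
    have p: "p \<in> Y" using \<sigma>_in[OF t] by (simp add: p_def)
    define A where "A = dist p z"
    have V0: "V > 0"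
    proof -
      have "0 < (v j)\<^sup>2" using j \<mu> by simp
      also have "\<dots> \<le> V" unfolding V_def using j by (intro member_le_sum) auto
      finally show ?thesis .
    qed
    \<comment> \<open>Because \<open>v\<close> consists of positive parts, weighting with
      \<open>v\<close> turns \<open>g\<close> at \<open>z\<close> into the Bessel sum
      \<open>V\<close>, up to the scale \<open>\<mu>\<close>.\<close>
    have "v i * cosd (x i) z = (v i)\<^sup>2" for i by (simp add: v_def max_def power2_eq_square)
    then have gz: "g t z = V / \<mu>" by (simp add: g_def t_def V_def sum_divide_distrib)
    have "(\<mu> * G t) = (\<Sum>i<n. v i * cosd (x i) p)"
      unfolding G_def p_def[symmetric] g_def using \<mu> by (simp add: t_def sum_distrib_left)
    also have "\<dots> \<le> (\<Sum>i<n. v i * max 0 (cosd (x i) p))"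
      by (intro sum_mono mult_left_mono) (auto simp: v_def)
    finally have "(\<mu> * G t)\<^sup>2 \<le> (\<Sum>i<n. v i * max 0 (cosd (x i) p))\<^sup>2"
      using \<mu> G_lower[OF t] by (intro power_mono) auto
    also have "\<dots> \<le> V * (\<Sum>i<n. (max 0 (cosd (x i) p))\<^sup>2)"
      unfolding V_def by (rule Cauchy_Schwarz_ineq_sum)
    also have "\<dots> \<le> V * (1 + e)" using Bessel[OF p] V0 by (intro mult_left_mono) auto
    finally have GV: "(\<mu> * G t)\<^sup>2 \<le> V * (1 + e)" .
    have "V / \<mu> \<le> cos A * G t" using first_variation[OF t z] gz by (simp add: A_def p_def)
    then have VA: "V \<le> cos A * (\<mu> * G t)" using \<mu> by (simp add: field_simps)
    have mG: "0 < \<mu> * G t" using \<mu> G_lower[OF t] by simp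
    have "0 < cos A * (\<mu> * G t)" using VA V0 by linarith
    then have cA: "0 < cos A" using mG by (simp add: zero_less_mult_iff)
    have "V\<^sup>2 \<le> (cos A * (\<mu> * G t))\<^sup>2" using VA V0 by (intro power_mono) auto
    also have "\<dots> = (cos A)\<^sup>2 * (\<mu> * G t)\<^sup>2" by (simp add: power_mult_distrib)
    also have "\<dots> \<le> (cos A)\<^sup>2 * (V * (1 + e))" using GV by (intro mult_left_mono) auto
    finally have "V * V \<le> V * ((cos A)\<^sup>2 * (1 + e))" by (simp add: power2_eq_square mult_ac)
    then have Vc: "V \<le> (cos A)\<^sup>2 * (1 + e)" using V0 by simp
    have B: "0 \<le> B" "B \<le> pi / 2"
      using dist_le_half_pi_minus_cosd[of z y] yc[OF z] 3(3) by (auto simp: B_def dist_commute)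
    have sB: "0 \<le> sin B" "sin B \<le> 1" using B by (auto intro: sin_ge_zero)
    \<comment> \<open>The triangle inequality gives \<open>pi / 2 - B - \<kappa> \<le> A\<close>;
      cosine is 1-Lipschitz, and \<open>cos (pi / 2 - B)\<close> is \<open>sin B\<close>.\<close>
    have cAB: "cos A \<le> sin B + \<kappa>"
    proof -
      have "pi / 2 - \<kappa> \<le> dist y p" using far t by (auto simp: p_def)
      also have "\<dots> \<le> B + A" using dist_triangle[of y p z] by (simp add: A_def B_def dist_commute)
      finally have AB: "pi / 2 - B - \<kappa> \<le> A" by simp
      have A0: "0 \<le> A" by (simp add: A_def)
      have A: "A \<le> pi" using pair(1)[OF t \<sigma>_in[OF t] _ z] G_lower[OF t] by (simp add: A_def p_def G_def)
      have "cos A - cos (pi / 2 - B) \<le> \<kappa>"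
      proof (cases "A \<le> pi / 2 - B")
        case True
        have "cos A - cos (pi / 2 - B) = 2 * sin ((A + (pi / 2 - B)) / 2) * sin ((pi / 2 - B - A) / 2)"
          by (rule cos_diff_cos)
        also have "\<dots> \<le> 2 * 1 * ((pi / 2 - B - A) / 2)"
        proof (rule mult_mono)
          show "sin ((pi / 2 - B - A) / 2) \<le> (pi / 2 - B - A) / 2" using True by (intro sin_x_le_x) auto
          show "0 \<le> sin ((pi / 2 - B - A) / 2)"
          proof (rule sin_ge_zero)
            have "pi / 2 - B - A \<le> pi / 2" using B A0 by linarith
            also have "\<dots> \<le> 2 * pi" using pi_ge_zero by linarith
            finally show "(pi / 2 - B - A) / 2 \<le> pi" by simp
          qed (use True in simp)
        qed auto
        also have "\<dots> \<le> \<kappa>" using AB by simp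
        finally show ?thesis .
      next
        case False
        then have "cos A \<le> cos (pi / 2 - B)" using A B by (intro cos_monotone_0_pi_le) auto
        then show ?thesis using \<kappa> by simp
      qed
      then show ?thesis by (simp add: cos_diff)
    qed
    have "(cos A)\<^sup>2 \<le> (sin B + \<kappa>)\<^sup>2" using cAB cA by (intro power_mono) auto
    also have "\<dots> = (sin B)\<^sup>2 + 2 * (sin B * \<kappa>) + \<kappa> * \<kappa>" by (simp add: power2_eq_square algebra_simps)
    also have "\<dots> \<le> (sin B)\<^sup>2 + 2 * (1 * \<kappa>) + 1 * \<kappa>"
      using sB \<kappa> by (intro add_mono mult_left_mono mult_right_mono) auto
    finally have c1: "(cos A)\<^sup>2 \<le> (sin B)\<^sup>2 + 3 * \<kappa>" by simp
    have c2: "(cos A)\<^sup>2 * e \<le> 1 * e" using e_pos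
      by (intro mult_right_mono) (auto simp: power_le_one_iff abs_square_le_1)
    have "(max 0 (cosd y z))\<^sup>2 = (cos B)\<^sup>2" using 3(3) by (simp add: cosd_def B_def)
    moreover have "V \<le> (cos A)\<^sup>2 + (cos A)\<^sup>2 * e" using Vc by (simp add: distrib_left)
    ultimately have "V + (max 0 (cosd y z))\<^sup>2 \<le> 1 + 3 * \<kappa> + 4 * e"
      using c1 c2 e_pos sin_cos_squared_add[of B] by linarith
    then show ?thesis by (simp add: V_def v_def)
  qed
qed

end

section \<open>Consequences of finite dimension\<close>

lemma refinable_mono:
  assumes ref: "refinable T m" and le: "m \<le> m'" shows "refinable T m'"
  unfolding refinable_def
proof (intro allI impI)
  fix \<U> assume cover: "open_cover T \<U>"
  from ref[unfolded refinable_def, THEN spec, THEN mp, OF cover]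
  obtain \<V> where \<V>: "open_cover T \<V> \<and> (\<forall>V\<in>\<V>. \<exists>U\<in>\<U>. V \<subseteq> U) \<and>
      (\<forall>q\<in>topspace T. finite {V\<in>\<V>. q \<in> V} \<and> card {V\<in>\<V>. q \<in> V} \<le> m)"
    by (rule exE)
  have 2: "\<forall>q\<in>topspace T. finite {V\<in>\<V>. q \<in> V} \<and> card {V\<in>\<V>. q \<in> V} \<le> m'"
  proof
    fix q assume "q \<in> topspace T"
    from bspec[OF \<V>[THEN conjunct2, THEN conjunct2] this] le
    show "finite {V\<in>\<V>. q \<in> V} \<and> card {V\<in>\<V>. q \<in> V} \<le> m'" by linarith
  qed
  show "\<exists>\<V>. open_cover T \<V> \<and> (\<forall>V\<in>\<V>. \<exists>U\<in>\<U>. V \<subseteq> U) \<and>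
      (\<forall>q\<in>topspace T. finite {V\<in>\<V>. q \<in> V} \<and> card {V\<in>\<V>. q \<in> V} \<le> m')"
    by (intro exI conjI, rule \<V>[THEN conjunct1],
      rule \<V>[THEN conjunct2, THEN conjunct1], rule 2)
qed

lemma geometric_dim_finite_refinable:
  assumes "geometric_dim X < \<infinity>"
  obtains M where "\<And>K. compact K \<Longrightarrow> K \<subseteq> X \<Longrightarrow> refinable (top_of_set K) M"
proof -
  obtain D :: nat where D: "geometric_dim X < ereal (real D)"
    using assms less_PInf_Ex_of_nat by auto
  have "refinable (top_of_set K) (D + 1)" if "compact K" "K \<subseteq> X" for K
  proof -
    have "covering_dim (top_of_set K) \<le> geometric_dim X"
      unfolding geometric_dim_def using that by (intro SUP_upper) auto
    then have "covering_dim (top_of_set K) < ereal (real D)" using D by (rule le_less_trans)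
    then obtain m where "refinable (top_of_set K) m" "ereal (real m - 1) < ereal (real D)"
      unfolding covering_dim_def by (auto simp: INF_less_iff)
    then show ?thesis using refinable_mono[of _ m "D + 1"] by auto
  qed
  then show ?thesis using that by blast
qed

text \<open>Members of the refinement assigned to the same \<open>U i\<close> are united. The
  assignment \<open>\<iota>\<close> maps the members containing \<open>q\<close> onto the indices of
  the sets containing \<open>q\<close>, so the multiplicity does not grow.\<close>

lemma refinable_shrink:
  fixes U :: "nat \<Rightarrow> 'a set"
  assumes ref: "refinable T m" and cover: "open_cover T (U ` {..<n})"
  obtains W where "\<And>i. openin T (W i)" "\<And>i. W i \<subseteq> U i"
    "\<And>q. q \<in> topspace T \<Longrightarrow> \<exists>i<n. q \<in> W i"
    "\<And>q. q \<in> topspace T \<Longrightarrow> card {i. i < n \<and> q \<in> W i} \<le> m"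
proof -
  from ref[unfolded refinable_def, THEN spec, THEN mp, OF cover]
  obtain \<V> where \<V>: "open_cover T \<V> \<and> (\<forall>V\<in>\<V>. \<exists>W\<in>U ` {..<n}. V \<subseteq> W) \<and>
      (\<forall>q\<in>topspace T. finite {V\<in>\<V>. q \<in> V} \<and> card {V\<in>\<V>. q \<in> V} \<le> m)"
    by (rule exE)
  note V = \<V>[THEN conjunct1] \<V>[THEN conjunct2, THEN conjunct1]
    and mult = \<V>[THEN conjunct2, THEN conjunct2]
  have "\<exists>i<n. V \<subseteq> U i" if mem: "V \<in> \<V>" for V
  proof -
    obtain V' where V': "V' \<in> U ` {..<n}" "V \<subseteq> V'" using bspec[OF V(2) mem] by (rule bexE)
    from V'(1) obtain i where "V' = U i" "i \<in> {..<n}" by (rule imageE)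
    then show ?thesis using V'(2) by auto
  qed
  then obtain \<iota> where \<iota>: "\<And>V. V \<in> \<V> \<Longrightarrow> \<iota> V < n" "\<And>V. V \<in> \<V> \<Longrightarrow> V \<subseteq> U (\<iota> V)" by metis
  have V_open: "\<And>V. V \<in> \<V> \<Longrightarrow> openin T V" and V_cover: "topspace T = \<Union>\<V>"
    using V(1) unfolding open_cover_def by blast+
  define W where "W = (\<lambda>i. \<Union>{V\<in>\<V>. \<iota> V = i})"
  show ?thesis
  proof (rule that[of W])
    show "openin T (W i)" for i unfolding W_def using V_open by (intro openin_Union) blast
    show "W i \<subseteq> U i" for i using \<iota>(2) unfolding W_def by blast
    show "\<exists>i<n. q \<in> W i" if q: "q \<in> topspace T" for q
    proof -
      obtain V where "V \<in> \<V>" "q \<in> V" using q unfolding V_cover by (rule UnionE)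
      then show ?thesis using \<iota>(1)[of V] unfolding W_def by blast
    qed
    show "card {i. i < n \<and> q \<in> W i} \<le> m" if q: "q \<in> topspace T" for q
    proof -
      have "{i. i < n \<and> q \<in> W i} \<subseteq> \<iota> ` {V\<in>\<V>. q \<in> V}" unfolding W_def by blast
      then show ?thesis
        using surj_card_le[of "{V\<in>\<V>. q \<in> V}" "{i. i < n \<and> q \<in> W i}" \<iota>] bspec[OF mult q] by simp
    qed
  qed
qed

text \<open>With multiplicity at most \<open>M = n - 1\<close>, every point lies in some but not all
  of the \<open>n\<close> sets \<open>W i\<close>, so the functions \<open>w i\<close>, positive
  exactly on \<open>W i\<close>, never all agree. The Poincare-Miranda theorem produces a point
  where they do.\<close>

lemma (in near_orthonormal) not_refinable:
  assumes n: "n = Suc M" and small: "e + 4 * (real n)\<^sup>2 * e \<le> (1 / (8 * real n))\<^sup>2"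
  shows "\<not> refinable (top_of_set (\<sigma> ` params)) M"
proof
  define K where "K = \<sigma> ` params"
  assume ref: "refinable (top_of_set (\<sigma> ` params)) M"
  \<comment> \<open>The threshold separates two coordinate estimates: it is exceeded when
    \<open>1/2 \<le> t i\<close> and, by \<open>small\<close>, not exceeded when
    \<open>t i = 0\<close>.\<close>
  define U where "U = (\<lambda>i. {q \<in> K. 1 / (8 * real n) < cosd (x i) q})"
  have cosd_cont: "continuous_on K (cosd z)" for z
    unfolding continuous_on_def by (intro ballI tendsto_cosd tendsto_ident_at)
  have U_open: "openin (top_of_set K) (U i)" for i
  proof -
    have "U i = K \<inter> cosd (x i) -` {1 / (8 * real n)<..}" by (auto simp: U_def)
    then show ?thesis using continuous_openin_preimage_gen[OF cosd_cont open_greaterThan] by simp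
  qed
  have U_cover: "\<Union>(U ` {..<n}) = K"
  proof -
    have "\<exists>i<n. \<sigma> t \<in> U i" if t: "t \<in> params" for t
    proof -
      obtain j where "j < n" "1/2 \<le> t j" using t by (auto simp: params_def)
      then show ?thesis using \<sigma>_large_coord[OF t, of j] t unfolding U_def K_def by blast
    qed
    then have "K \<subseteq> \<Union>(U ` {..<n})" unfolding K_def by blast
    then show ?thesis unfolding U_def by blast
  qed
  have U_zero: "\<sigma> t \<notin> U i" if t: "t \<in> params" and i: "i < n" "t i = 0" for t i
  proof
    assume "\<sigma> t \<in> U i"
    then have "(1 / (8 * real n))\<^sup>2 < (max 0 (cosd (x i) (\<sigma> t)))\<^sup>2"
      by (intro power_strict_mono) (auto simp: U_def)
    then show False using \<sigma>_zero_coord[OF t i] small by linarith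
  qed
  have cover: "open_cover (top_of_set K) (U ` {..<n})"
    using U_open U_cover unfolding open_cover_def by simp
  then obtain W where W_open: "\<And>i. openin (top_of_set K) (W i)" and W_sub: "\<And>i. W i \<subseteq> U i"
    and W_cover: "\<And>q. q \<in> K \<Longrightarrow> \<exists>i<n. q \<in> W i"
    and W_mult: "\<And>q. q \<in> K \<Longrightarrow> card {i. i < n \<and> q \<in> W i} \<le> M"
    using refinable_shrink[OF ref[folded K_def], of U n] by auto
  have W_empty: "\<exists>i<n. q \<notin> W i" if q: "q \<in> K" for q
  proof (rule ccontr)
    assume "\<not> ?thesis"
    then have "{i. i < n \<and> q \<in> W i} = {..<n}" by auto
    then show False using W_mult[OF q] n by simp
  qed
  \<comment> \<open>The value 1 replaces the distance to an empty complement, for which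
    \<open>infdist\<close> would be 0.\<close>
  define w where "w = (\<lambda>i q. if K - W i = {} then 1 else infdist q (K - W i))"
  have w_cont: "continuous_on K (w i)" for i
  proof (cases "K - W i = {}")
    case True
    then show ?thesis unfolding w_def by simp
  next
    case False
    then show ?thesis unfolding w_def if_not_P[OF False] by (intro continuous_on_infdist continuous_on_id)
  qed
  have w_nonneg: "0 \<le> w i q" for i q by (simp add: w_def infdist_nonneg)
  have w_pos: "0 < w i q \<longleftrightarrow> q \<in> W i" if "q \<in> K" for i q
  proof (cases "K - W i = {}")
    case True
    then show ?thesis using that unfolding w_def by auto
  next
    case False
    have "closedin (top_of_set K) (K - W i)" using W_open by (simp add: closedin_diff)
    then have "closed (K - W i)"
      using compact_\<sigma>_image compact_imp_closed closedin_closed_trans unfolding K_def by blast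
    then have "q \<in> K - W i \<longleftrightarrow> infdist q (K - W i) = 0"
      using False by (rule in_closed_iff_infdist_zero)
    moreover have "w i q = infdist q (K - W i)" unfolding w_def using False by (rule if_not_P)
    ultimately show ?thesis using that w_nonneg[of i q] by force
  qed
  \<comment> \<open>The cube maps to the parameters so that the faces \<open>u i = 0\<close> and \<open>u i = 1\<close> give \<open>t i = 0\<close>
    and \<open>t M = 0\<close>; the cut-off in \<open>t M\<close> keeps some coordinate at least \<open>1/2\<close>.\<close>
  define \<tau> where "\<tau> = (\<lambda>(u::nat \<Rightarrow> real) i. if i < M then u i else if i = M then \<Prod>j<M. min 1 (2 - 2 * u j) else 0)"
  have \<tau>_params: "\<tau> u \<in> params" if u: "u \<in> unit_box" for u
  proof -
    have "0 \<le> (\<Prod>j<M. min 1 (2 - 2 * u j))" using u by (intro prod_nonneg) auto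
    moreover have "(\<Prod>j<M. min 1 (2 - 2 * u j)) \<le> 1" using u by (intro prod_le_1) auto
    ultimately have box: "\<tau> u \<in> unit_box" using u by (simp add: \<tau>_def)
    show ?thesis
    proof (cases "\<exists>j<M. 1/2 \<le> u j")
      case True
      then obtain j where "j < M" "1/2 \<le> \<tau> u j" by (auto simp: \<tau>_def)
      then show ?thesis unfolding params_def using box n by (auto intro!: bexI[of _ j])
    next
      case False
      then have "\<tau> u M = 1" by (auto simp: \<tau>_def intro!: prod.neutral)
      then show ?thesis unfolding params_def using box n by (auto intro!: bexI[of _ M])
    qed
  qed
  have "continuous_on unit_box (\<lambda>u. \<tau> u i)" for i
    unfolding \<tau>_def
    by (cases "i < M"; cases "i = M")
      (auto intro!: continuous_intros continuous_on_subset[OF continuous_on_product_coordinates])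
  then have \<tau>_cont: "continuous_on unit_box \<tau>" by (rule continuous_on_coordinatewise_then_product)
  have \<sigma>\<tau>: "continuous_on unit_box (\<lambda>u. \<sigma> (\<tau> u))"
    using continuous_on_compose2[OF continuous_on_\<sigma> \<tau>_cont] \<tau>_params by blast
  have in_K: "\<sigma> (\<tau> u) \<in> K" if "u \<in> unit_box" for u
    using \<tau>_params[OF that] by (simp add: K_def)
  have w_zero: "w i (\<sigma> (\<tau> u)) = 0" if u: "u \<in> unit_box" and i: "i < n" "\<tau> u i = 0" for u i
    using U_zero[OF \<tau>_params[OF u] i] W_sub[of i] w_pos[OF in_K[OF u], of i] w_nonneg[of i "\<sigma> (\<tau> u)"]
    by (auto simp: less_le)
  \<comment> \<open>Comparing with index \<open>M\<close> turns equality of all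
    \<open>n = M + 1\<close> functions into \<open>M\<close> equations on an
    \<open>M\<close>-dimensional cube.\<close>
  define h where "h = (\<lambda>i u. w i (\<sigma> (\<tau> u)) - w M (\<sigma> (\<tau> u)))"
  obtain u where u: "u \<in> unit_box" "\<And>i. i < M \<Longrightarrow> h i u = 0"
  proof (rule Poincare_Miranda[of M h])
    have "continuous_on unit_box (\<lambda>u. w i (\<sigma> (\<tau> u)))" for i
      using continuous_on_compose2[OF w_cont \<sigma>\<tau>] in_K by blast
    then show "continuous_on unit_box (h i)" for i unfolding h_def by (intro continuous_on_diff)
    show "h i u \<le> 0" if "i < M" "u \<in> unit_box" "u i = 0" for i u
      using w_zero[OF that(2), of i] that n w_nonneg by (simp add: h_def \<tau>_def)
    show "0 \<le> h i u" if "i < M" "u \<in> unit_box" "u i = 1" for i u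
    proof -
      have "\<tau> u M = 0" using that by (auto simp: \<tau>_def intro!: bexI[of _ i])
      then show ?thesis using w_zero[OF that(2), of M] n w_nonneg by (simp add: h_def)
    qed
  qed blast
  define q where "q = \<sigma> (\<tau> u)"
  have q: "q \<in> K" using in_K u by (simp add: q_def)
  have eq: "w i q = w M q" if "i < n" for i
    using u(2)[of i] that n by (cases "i = M") (auto simp: h_def q_def)
  obtain i j where "i < n" "q \<in> W i" "j < n" "q \<notin> W j" using W_cover[OF q] W_empty[OF q] by blast
  then show False using w_pos[OF q] eq by metis
qed

section \<open>Construction of almost orthonormal systems\<close>

text \<open>Given \<open>n\<close> points, the compact simplex is covered by small balls about a
  finite set \<open>P\<close>, and \<open>far\<close> applied to \<open>P\<close> provides the next
  point. By the triangle inequality it is far enough from the whole simplex for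
  \<open>Bessel_extend\<close>.\<close>

lemma near_orthonormal_exists:
  fixes Y :: "'a::metric_space set"
  assumes cat: "CAT1 Y"
    and far: "\<And>P \<eta>. finite P \<Longrightarrow> P \<subseteq> Y \<Longrightarrow> 0 < \<eta> \<Longrightarrow>
      \<exists>y\<in>Y. (\<forall>z\<in>Y. dist y z \<le> pi / 2 + \<eta>) \<and> (\<forall>p\<in>P. pi / 2 - \<eta> \<le> dist y p)"
  shows "0 < \<delta> \<Longrightarrow> \<exists>x e. e \<le> \<delta> \<and> near_orthonormal Y x n e"
proof (induction n arbitrary: \<delta>)
  case 0
  then have "near_orthonormal Y x 0 (min \<delta> (1/32))" for x
    using cat by unfold_locales auto
  then show ?case by (intro exI[of _ "\<lambda>_. undefined"] exI[of _ "min \<delta> (1/32)"]) auto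
next
  case (Suc n)
  define d where "d = min \<delta> (1 / (32 * (real n + 2)))"
  have d: "0 < d" "d \<le> \<delta>" "32 * (real (Suc n) + 1) * d \<le> 1"
  proof -
    show "0 < d" "d \<le> \<delta>" using Suc.prems by (auto simp: d_def)
    have "d \<le> 1 / (32 * (real n + 2))" by (simp add: d_def)
    then show "32 * (real (Suc n) + 1) * d \<le> 1" by (simp add: pos_le_divide_eq algebra_simps)
  qed
  have d1: "d \<le> 1"
  proof -
    have "1 * d \<le> 32 * (real (Suc n) + 1) * d" using d(1) by (intro mult_right_mono) auto
    then show ?thesis using d(3) by linarith
  qed
  \<comment> \<open>The tolerances \<open>d / 8\<close> here and \<open>d / 12\<close> below make
    the new Bessel error at most \<open>3 * (d / 6) + 4 * (d / 8) = d\<close>; the net and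
    \<open>far\<close> each contribute \<open>d / 12\<close> to \<open>d / 6\<close>.\<close>
  obtain x e where e: "e \<le> d / 8" and no: "near_orthonormal Y x n e"
    using Suc.IH[of "d / 8"] d by auto
  interpret near_orthonormal Y x n e by fact
  obtain P where P: "finite P" "P \<subseteq> \<sigma> ` params" "\<sigma> ` params \<subseteq> (\<Union>p\<in>P. ball p (d / 12))"
    using seq_compact_imp_totally_bounded[OF compact_imp_seq_compact[OF compact_\<sigma>_image], rule_format, of "d / 12"]
      d(1) by auto
  have "P \<subseteq> Y" using P(2) \<sigma>_in by auto
  then obtain y where y: "y \<in> Y" "\<And>z. z \<in> Y \<Longrightarrow> dist y z \<le> pi / 2 + d / 12"
    "\<And>p. p \<in> P \<Longrightarrow> pi / 2 - d / 12 \<le> dist y p"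
    using far[of P "d / 12"] P(1) d(1) by auto
  have "near_orthonormal Y (x(n := y)) (Suc n) d"
  proof unfold_locales
    show "CAT1 Y" "0 < d" "32 * (real (Suc n) + 1) * d \<le> 1" by fact+
    show "(x(n := y)) i \<in> Y" if "i < Suc n" for i using that y xY by (auto simp: less_Suc_eq)
    show "dist ((x(n := y)) i) z \<le> pi / 2 + d" if "i < Suc n" "z \<in> Y" for i z
      using that y(2)[of z] center[of i z] e d(1) by (auto simp: less_Suc_eq)
    fix z assume z: "z \<in> Y"
    have "(\<Sum>i<n. (max 0 (cosd (x i) z))\<^sup>2) + (max 0 (cosd y z))\<^sup>2 \<le> 1 + 3 * (d / 6) + 4 * e"
    proof (rule Bessel_extend[OF y(1) _ _ _ _ z])
      fix q assume "q \<in> \<sigma> ` params"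
      then obtain p where "p \<in> P" "dist p q < d / 12" using P(3) by auto
      then show "pi / 2 - d / 6 \<le> dist y q"
        using y(3)[of p] dist_triangle[of y p q] by (simp add: dist_commute)
    next
      show "dist y z \<le> pi" if "z \<in> Y" for z using y(2)[OF that] d1 pi_gt3 by simp
    qed (use d(1) d1 in auto)
    then show "(\<Sum>i<Suc n. (max 0 (cosd ((x(n := y)) i) z))\<^sup>2) \<le> 1 + d"
      using e by simp
  qed
  then show ?case using d(2) by blast
qed

lemma finite_dim_obstruction:
  fixes Y :: "'a::metric_space set"
  assumes cat: "CAT1 Y" and dim: "geometric_dim Y < \<infinity>"
  obtains P \<eta> where "finite P" "P \<subseteq> Y" "0 < \<eta>"
    "\<And>y. y \<in> Y \<Longrightarrow> \<forall>z\<in>Y. dist y z \<le> pi / 2 + \<eta> \<Longrightarrow> \<exists>p\<in>P. dist y p < pi / 2 - \<eta>"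
proof (rule ccontr)
  assume "\<not> thesis"
  with that have far: "\<exists>y\<in>Y. (\<forall>z\<in>Y. dist y z \<le> pi / 2 + \<eta>) \<and> (\<forall>p\<in>P. pi / 2 - \<eta> \<le> dist y p)"
    if "finite P" "P \<subseteq> Y" "0 < \<eta>" for P \<eta>
    using that by (meson linorder_not_less)
  obtain M where M: "\<And>K. compact K \<Longrightarrow> K \<subseteq> Y \<Longrightarrow> refinable (top_of_set K) M"
    using geometric_dim_finite_refinable[OF dim] by blast
  define n where "n = Suc M"
  \<comment> \<open>The smallness condition of \<open>not_refinable\<close>, solved for
    \<open>e\<close>.\<close>
  define \<delta> where "\<delta> = (1 / (8 * real n))\<^sup>2 / (1 + 4 * (real n)\<^sup>2)"
  have pos: "0 < 1 + 4 * (real n)\<^sup>2" by (simp add: add_pos_nonneg)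
  then have "0 < \<delta>" by (simp add: \<delta>_def n_def)
  then obtain x e where e: "e \<le> \<delta>" and "near_orthonormal Y x n e"
    using near_orthonormal_exists[OF cat far] by blast
  then interpret near_orthonormal Y x n e by blast
  have "e * (1 + 4 * (real n)\<^sup>2) \<le> (1 / (8 * real n))\<^sup>2"
    using e pos by (simp add: \<delta>_def pos_le_divide_eq)
  then have "\<not> refinable (top_of_set (\<sigma> ` params)) M"
    by (intro not_refinable n_def) (simp add: algebra_simps)
  moreover have "\<sigma> ` params \<subseteq> Y" using \<sigma>_in by blast
  ultimately show False using M[OF compact_\<sigma>_image] by blast
qed

section \<open>Spaces of radius less than a right angle\<close>

text \<open>\<open>F x\<close> is the cosine of the radius at \<open>x\<close>, since cosine
  decreases on \<open>[0, pi]\<close> and all distances are less than \<open>pi\<close>. The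
  midpoint inequality makes its maximum point exist and be unique, and isometries preserve
  \<open>F\<close>.\<close>

lemma circumcenter_of_small_radius:
  fixes Y :: "'a::metric_space set"
  assumes cat: "CAT1 Y" and q: "q \<in> Y" and rho: "\<rho> < pi / 2" "\<And>z. z \<in> Y \<Longrightarrow> dist q z \<le> \<rho>"
  shows "\<exists>x. circumcenter Y x \<and> (\<forall>f. isometry_of Y f \<longrightarrow> f x = x)"
proof -
  define F where "F = (\<lambda>x. INF z\<in>Y. cosd z x)"
  have rho0: "0 \<le> \<rho>" using rho(2)[OF q] by simp
  have diam: "dist x z < pi" if "x \<in> Y" "z \<in> Y" for x z
    using rho(1) rho(2)[OF that(1)] rho(2)[OF that(2)] dist_triangle[of x z q] by (simp add: dist_commute)
  have bdd: "bdd_below ((\<lambda>z. cosd z x) ` Y)" for x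
    using cosd_bounds[of _ x] by (intro bdd_belowI2[where m="-1"]) (simp add: abs_le_iff minus_le_iff)
  have F_le: "F x \<le> cosd z x" if "z \<in> Y" for x z
    unfolding F_def using bdd that by (rule cINF_lower)
  have F_ge: "c \<le> F x" if "\<And>z. z \<in> Y \<Longrightarrow> c \<le> cosd z x" for c x
    unfolding F_def using q that by (intro cINF_greatest) auto
  have Fq: "cos \<rho> \<le> F q"
    using rho rho0 by (intro F_ge cosd_mono) (auto intro: less_imp_le[OF diam[OF q]])
  have cr: "0 < cos \<rho>" using rho0 rho(1) by (intro cos_gt_zero_pi) auto
  \<comment> \<open>A point with \<open>F x > 0\<close> has all of \<open>Y\<close> within less than
    a right angle, which keeps the perimeters in \<open>mid\<close> below
    \<open>2 * pi\<close>.\<close>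
  have near: "dist x z < pi / 2" if "x \<in> Y" "z \<in> Y" "0 < F x" for x z
    using dist_le_half_pi_minus_cosd[of x z] diam[OF that(1,2)] F_le[OF that(2), of x] that(3) by simp
  have mid: "\<exists>m\<in>Y. F x + F y \<le> 2 * cos (dist x y / 2) * F m"
    if xy: "x \<in> Y" "y \<in> Y" "0 < F x" "0 < F y" for x y
  proof -
    obtain m where m: "m \<in> Y" "\<And>z. z \<in> Y \<Longrightarrow> dist x y + dist x z + dist y z < 2 * pi \<Longrightarrow>
        cosd z x + cosd z y \<le> 2 * cos (dist x y / 2) * cosd z m"
      using CAT1_midpoint[OF cat xy(1,2) diam[OF xy(1,2)]] by metis
    have c: "0 < cos (dist x y / 2)"
      using diam[OF xy(1,2)] by (intro cos_gt_zero_pi) (auto intro: less_le_trans[of _ 0])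
    have "(F x + F y) / (2 * cos (dist x y / 2)) \<le> F m"
    proof (rule F_ge)
      fix z assume z: "z \<in> Y"
      have "dist x y + dist x z + dist y z < 2 * pi"
        using near[OF xy(1) xy(2) xy(3)] near[OF xy(1) z xy(3)] near[OF xy(2) z xy(4)] pi_gt_zero by linarith
      then have "F x + F y \<le> 2 * cos (dist x y / 2) * cosd z m"
        using m(2)[OF z] F_le[OF z, of x] F_le[OF z, of y] by linarith
      then show "(F x + F y) / (2 * cos (dist x y / 2)) \<le> cosd z m"
        using c by (simp add: pos_divide_le_eq mult.commute)
    qed
    then have "F x + F y \<le> 2 * cos (dist x y / 2) * F m"
      using c by (simp add: pos_divide_le_eq mult.commute)
    then show ?thesis using m(1) by blast
  qed
  obtain y where y: "\<And>k. y k \<in> Y" "Cauchy y" "\<And>k x. x \<in> Y \<Longrightarrow> F x \<le> F (y k) + 1 / real (k + 1)"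
  proof (rule Cauchy_near_maximizers[of "\<lambda>_. Y" "cos \<rho>" F 1])
    show "F y \<le> 1" for y using F_le[OF q, of y] cosd_bounds[of q y] by simp
    show "\<exists>y\<in>Y. cos \<rho> \<le> F y" using q Fq by blast
    show "dist x y < pi \<and> (\<exists>m\<in>Y. F x + F y \<le> 2 * cos (dist x y / 2) * F m)"
      if "x \<in> Y" "y \<in> Y" "0 < F x" "0 < F y" for x y
      using mid[OF that] diam[OF that(1,2)] by blast
  qed (use cr in \<open>auto simp: decseq_def\<close>)
  obtain c where c: "c \<in> Y" and lim: "y \<longlonglongrightarrow> c"
    using cat y(1,2) unfolding CAT1_def complete_def by metis
  have max: "F x \<le> F c" if x: "x \<in> Y" for x
  proof (rule F_ge)
    fix z assume z: "z \<in> Y"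
    have "(\<lambda>k. cosd z (y k) + 1 / real (k + 1)) \<longlonglongrightarrow> cosd z c + 0"
      by (intro tendsto_add tendsto_cosd lim LIMSEQ_Suc[OF lim_const_over_n, simplified Suc_eq_plus1])
    moreover have "F x \<le> cosd z (y k) + 1 / real (k + 1)" for k
      using y(3)[OF x, of k] F_le[OF z, of "y k"] by linarith
    ultimately show "F x \<le> cosd z c" by (intro LIMSEQ_le_const[of _ "cosd z c + 0", simplified]) auto
  qed
  have Fc: "0 < F c" using max[OF q] Fq cr by linarith
  have unique: "x = c" if x: "x \<in> Y" "F x = F c" for x
  proof (rule ccontr)
    assume "x \<noteq> c"
    obtain m where m: "m \<in> Y" "F x + F c \<le> 2 * cos (dist x c / 2) * F m"
      using mid[OF x(1) c] x(2) Fc by auto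
    have d: "0 < dist x c / 2" "dist x c / 2 < pi / 2" using \<open>x \<noteq> c\<close> diam[OF x(1) c] by auto
    have "0 < cos (dist x c / 2)" using d pi_gt_zero by (intro cos_gt_zero_pi) linarith+
    then have "cos (dist x c / 2) * F m \<le> cos (dist x c / 2) * F c" using max[OF m(1)] by simp
    then have "F c * 1 \<le> F c * cos (dist x c / 2)" using m(2) x(2) by (simp add: mult.commute)
    then have "1 \<le> cos (dist x c / 2)" using Fc by simp
    moreover have "cos (dist x c / 2) < cos 0" using d pi_gt_zero by (intro cos_monotone_0_pi) linarith+
    ultimately show False by simp
  qed
  have "radius_at Y c \<le> radius_at Y x" if x: "x \<in> Y" for x
    unfolding radius_at_def[of Y c]
  proof (rule SUP_least, rule ccontr)
    fix z assume z: "z \<in> Y" and "\<not> ereal (dist c z) \<le> radius_at Y x"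
    then obtain r where r: "radius_at Y x < ereal r" "r < dist c z"
      using ereal_dense2[of "radius_at Y x" "ereal (dist c z)"] by (auto simp: not_le)
    have rx: "dist x w < r" if "w \<in> Y" for w
      using SUP_lessD[OF r(1)[unfolded radius_at_def] that] by simp
    have r0: "0 \<le> r" using rx[OF x] by simp
    have rp: "r \<le> pi" using r(2) diam[OF c z] by simp
    have "cos r \<le> F x"
      using rx r0 rp diam[OF x] by (intro F_ge cosd_mono) (auto intro: less_imp_le)
    also have "\<dots> \<le> cosd z c" using max[OF x] F_le[OF z, of c] by linarith
    finally have "dist c z \<le> r" using dist_le_of_cosd[of c z r] r0 rp diam[OF c z] by simp
    then show False using r(2) by simp
  qed
  then have "radius_at Y c = radius Y"
    unfolding radius_def using c by (intro antisym INF_greatest INF_lower) auto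
  then have "circumcenter Y c" using c by (simp add: circumcenter_def)
  moreover have "f c = c" if f: "isometry_of Y f" for f
  proof (rule unique)
    show "f c \<in> Y" using f c by (auto simp: isometry_of_def)
    \<comment> \<open>Surjectivity of \<open>f\<close> permits reindexing the infimum by
      \<open>f\<close>.\<close>
    have "F (f c) = (INF z\<in>f ` Y. cosd z (f c))" using f by (simp add: F_def isometry_of_def)
    also have "\<dots> = (INF z\<in>Y. cosd (f z) (f c))" by (simp add: image_image)
    also have "\<dots> = F c" unfolding F_def using f c
      by (intro INF_cong) (auto simp: cosd_def isometry_of_def)
    finally show "F (f c) = F c" .
  qed
  ultimately show ?thesis by blast
qed

text \<open>When the radius is exactly \<open>pi / 2\<close>, these are the circumcenters of
  \<open>X\<close>.\<close>

definition hemicenters :: "'a::metric_space set \<Rightarrow> 'a set" where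
  "hemicenters X = {x\<in>X. \<forall>z\<in>X. dist x z \<le> pi / 2}"

text \<open>Completeness holds because closed balls cut the set out of \<open>X\<close>. It is
  convex because nonnegativity of \<open>cosd z\<close> at both ends passes to the whole geodesic;
  the perimeters involved are at most \<open>3 * pi / 2\<close>.\<close>

lemma CAT1_hemicenters:
  assumes cat: "CAT1 X" shows "CAT1 (hemicenters X)"
proof -
  let ?C = "hemicenters X"
  have sub: "?C \<subseteq> X" by (auto simp: hemicenters_def)
  have X: "complete X" using cat by (simp add: CAT1_def)
  have "?C = X \<inter> (\<Inter>z\<in>X. {x. dist x z \<le> pi / 2})" by (auto simp: hemicenters_def)
  moreover have "closed {x. dist x z \<le> pi / 2}" for z :: 'a
    by (intro closed_Collect_le continuous_intros)
  ultimately have "closed ?C" using complete_imp_closed[OF X] by (auto intro!: closed_INT)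
  then have "complete ?C" using sub X by (rule complete_closed_subset)
  moreover have "\<exists>c. geodesic dist ?C x y c" if xy: "x \<in> ?C" "y \<in> ?C" for x y
  proof -
    have xyX: "x \<in> X" "y \<in> X" and d: "dist x y \<le> pi / 2" using xy by (auto simp: hemicenters_def)
    then have lt: "dist x y < pi" using pi_gt_zero by linarith
    obtain c where c: "geodesic dist X x y c"
      using cat xyX lt unfolding CAT1_def by blast
    have "c s \<in> ?C" if s: "s \<in> {0..dist x y}" for s
      unfolding hemicenters_def
    proof (intro CollectI conjI ballI)
      show "c s \<in> X" using c s unfolding geodesic_def by blast
      fix z assume z: "z \<in> X"
      have dz: "dist x z \<le> pi / 2" "dist y z \<le> pi / 2" using xy z by (auto simp: hemicenters_def)
      show "dist (c s) z \<le> pi / 2"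
      proof (cases "x = y")
        case True
        then have "c s = x" using s c by (auto simp: geodesic_def)
        then show ?thesis using dz by simp
      next
        case False
        then have sl: "0 < sin (dist x y)" using lt by (intro sin_gt_zero) auto
        have "dist (c 0) (c s) = \<bar>0 - s\<bar>" "c 0 = x" using c s unfolding geodesic_def by auto
        then have "dist x (c s) = s" using s by simp
        then have dcs: "dist (c s) z \<le> pi"
          using dist_triangle[of "c s" z x] s d dz by (simp add: dist_commute)
        have "0 \<le> cosd z x" "0 \<le> cosd z y"
          using dz by (auto simp: cosd_def intro!: cos_ge_zero order_trans[OF _ zero_le_dist])
        moreover have "0 \<le> sin (dist x y - s)" "0 \<le> sin s" using s lt by (auto intro!: sin_ge_zero)
        ultimately have "0 \<le> sin (dist x y - s) * cosd z x + sin s * cosd z y" by simp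
        also have "\<dots> \<le> sin (dist x y) * cosd z (c s)"
          using CAT1_cos_comparison[OF cat xyX z _ c, of s] s d dz pi_gt_zero by simp
        finally have "0 \<le> cosd z (c s)" using sl by (simp add: zero_le_mult_iff)
        then show ?thesis using dist_le_half_pi_minus_cosd[of "c s" z] dcs by simp
      qed
    qed
    then show ?thesis using c unfolding geodesic_def by blast
  qed
  moreover have "geodesic_triangle dist X v c" if "geodesic_triangle dist ?C v c" for v c
    using that sub unfolding geodesic_triangle_def geodesic_def by blast
  ultimately show ?thesis using cat unfolding CAT1_def by blast
qed

text \<open>Induction over \<open>P\<close>: the new point is joined to the previous
  \<open>q\<close>, and the midpoint replaces \<open>q\<close>. As the diameter bound makes all
  cosines nonnegative, each of the two summands is at most twice the cosine at the midpoint; hence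
  the new constant \<open>min 1 \<kappa> / 2\<close>.\<close>

lemma common_near_point:
  fixes Y :: "'a::metric_space set"
  assumes cat: "CAT1 Y" and diam: "\<And>x z. x \<in> Y \<Longrightarrow> z \<in> Y \<Longrightarrow> dist x z \<le> pi / 2"
    and P: "finite P" "P \<noteq> {}" "P \<subseteq> Y"
  shows "\<exists>q\<in>Y. \<exists>\<kappa>>0. \<forall>x\<in>Y. \<forall>p\<in>P. \<kappa> * cosd x p \<le> cosd x q"
  using P
proof (induction P rule: finite_ne_induct)
  case (singleton p)
  then show ?case by (intro bexI[of _ p] exI[of _ 1]) auto
next
  case (insert p P)
  then obtain q \<kappa> where q: "q \<in> Y" "0 < \<kappa>" and \<kappa>: "\<forall>x\<in>Y. \<forall>p\<in>P. \<kappa> * cosd x p \<le> cosd x q" by auto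
  have p: "p \<in> Y" using insert.prems by auto
  have pos: "0 \<le> cosd z x" if "x \<in> Y" "z \<in> Y" for x z
    using diam[OF that] by (auto simp: cosd_def intro!: cos_ge_zero order_trans[OF _ zero_le_dist])
  have pq: "dist p q < pi" using diam[OF p q(1)] pi_gt_zero by linarith
  obtain m where m: "m \<in> Y" "\<And>z. z \<in> Y \<Longrightarrow> dist p q + dist p z + dist q z < 2 * pi \<Longrightarrow>
      cosd z p + cosd z q \<le> 2 * cos (dist p q / 2) * cosd z m"
    using CAT1_midpoint[OF cat p q(1) pq] by metis
  have le: "cosd x p + cosd x q \<le> 2 * cosd x m" if x: "x \<in> Y" for x
  proof -
    have "cosd x p + cosd x q \<le> 2 * (cos (dist p q / 2) * cosd x m)"
      using m(2)[OF x] diam[OF p q(1)] diam[OF p x] diam[OF q(1) x] pi_gt_zero by simp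
    also have "\<dots> \<le> 2 * (1 * cosd x m)"
      using pos[OF m(1) x] by (intro mult_left_mono mult_right_mono) auto
    finally show ?thesis by simp
  qed
  have "min 1 \<kappa> / 2 * cosd x p' \<le> cosd x m" if x: "x \<in> Y" and p': "p' \<in> insert p P" for x p'
  proof -
    have "p' \<in> Y" using p' insert.prems by auto
    then have p'0: "0 \<le> cosd x p'" using pos x by auto
    have "min 1 \<kappa> * cosd x p' \<le> cosd x p + cosd x q"
    proof (cases "p' = p")
      case True
      have "min 1 \<kappa> * cosd x p' \<le> 1 * cosd x p'" using p'0 by (intro mult_right_mono) auto
      then show ?thesis using True pos[OF q(1) x] by simp
    next
      case False
      have "min 1 \<kappa> * cosd x p' \<le> \<kappa> * cosd x p'" using p'0 by (intro mult_right_mono) auto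
      also have "\<dots> \<le> cosd x q" using \<kappa> x p' False by auto
      finally show ?thesis using pos[OF p x] by simp
    qed
    then show ?thesis using le[OF x] by simp
  qed
  then show ?case using m(1) q(2) by (intro bexI[of _ m] exI[of _ "min 1 \<kappa> / 2"]) auto
qed

section \<open>Spaces of radius a right angle\<close>

lemma geometric_dim_mono: "A \<subseteq> B \<Longrightarrow> geometric_dim A \<le> geometric_dim B"
  unfolding geometric_dim_def by (rule SUP_subset_mono) auto

lemma hemicenter_exists:
  fixes X :: "'a::metric_space set"
  assumes cat: "CAT1 X" and dim: "geometric_dim X < \<infinity>"
    and cen: "\<And>\<epsilon>. 0 < \<epsilon> \<Longrightarrow> \<exists>x\<in>X. \<forall>z\<in>X. dist x z \<le> pi / 2 + \<epsilon>"
  shows "hemicenters X \<noteq> {}"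
proof -
  \<comment> \<open>The detour through an almost center has length at most \<open>pi\<close> up to
    an arbitrarily small error.\<close>
  have diam: "dist z w \<le> pi" if "z \<in> X" "w \<in> X" for z w
  proof (rule field_le_epsilon)
    fix e :: real assume "0 < e"
    then obtain x where "x \<in> X" "\<forall>z\<in>X. dist x z \<le> pi / 2 + e / 2" using cen[of "e / 2"] by auto
    then have "dist x z \<le> pi / 2 + e / 2" "dist x w \<le> pi / 2 + e / 2" using that by auto
    then show "dist z w \<le> pi + e" using dist_triangle[of z w x] by (simp add: dist_commute)
  qed
  obtain P \<eta> where P: "finite P" "P \<subseteq> X" and \<eta>: "0 < \<eta>"
    and far: "\<And>y. y \<in> X \<Longrightarrow> \<forall>z\<in>X. dist y z \<le> pi / 2 + \<eta> \<Longrightarrow> \<exists>p\<in>P. dist y p < pi / 2 - \<eta>"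
    using finite_dim_obstruction[OF cat dim] by metis
  \<comment> \<open>Pigeonhole: the condition becomes stricter as \<open>\<epsilon>\<close> shrinks
    and \<open>P\<close> is finite, so one point of \<open>P\<close> serves all
    \<open>\<epsilon>\<close>.\<close>
  have "\<exists>p\<in>P. \<forall>\<epsilon>>0. \<exists>x\<in>X. (\<forall>z\<in>X. dist x z \<le> pi / 2 + \<epsilon>) \<and> dist x p < pi / 2 - \<eta>"
  proof (rule ccontr)
    assume "\<not> ?thesis"
    then obtain \<epsilon> where \<epsilon>: "\<And>p. p \<in> P \<Longrightarrow> 0 < \<epsilon> p \<and>
        \<not> (\<exists>x\<in>X. (\<forall>z\<in>X. dist x z \<le> pi / 2 + \<epsilon> p) \<and> dist x p < pi / 2 - \<eta>)"
      by metis
    define d where "d = Min (insert \<eta> (\<epsilon> ` P))"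
    have d: "0 < d" "d \<le> \<eta>" "\<And>p. p \<in> P \<Longrightarrow> d \<le> \<epsilon> p"
      using P(1) \<eta> \<epsilon> by (auto simp: d_def)
    obtain x where x: "x \<in> X" "\<And>z. z \<in> X \<Longrightarrow> dist x z \<le> pi / 2 + d" using cen[OF d(1)] by blast
    have "\<forall>z\<in>X. dist x z \<le> pi / 2 + \<eta>" using x(2) d(2) by force
    then obtain p where p: "p \<in> P" "dist x p < pi / 2 - \<eta>" using far[OF x(1)] by blast
    have "\<forall>z\<in>X. dist x z \<le> pi / 2 + \<epsilon> p" using x(2) d(3)[OF p(1)] by force
    then show False using \<epsilon>[OF p(1)] p(2) x(1) by blast
  qed
  then obtain p where p: "p \<in> X" and near: "\<And>\<epsilon>. 0 < \<epsilon> \<Longrightarrow>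
      \<exists>x\<in>X. (\<forall>z\<in>X. dist x z \<le> pi / 2 + \<epsilon>) \<and> dist x p < pi / 2 - \<eta>"
    using P(2) by blast
  have \<eta>': "\<eta> < pi / 2"
  proof -
    obtain x where "dist x p < pi / 2 - \<eta>" using near[of 1] by auto
    then show ?thesis using zero_le_dist[of x p] by linarith
  qed
  define c where "c = sin \<eta>"
  have c: "0 < c" using \<eta> \<eta>' by (auto simp: c_def intro: sin_gt_zero)
  define a where "a = (\<lambda>k. inverse (real (Suc k)) / 4)"
  have a: "0 < a k" "a k \<le> 1/4" for k by (simp_all add: a_def field_simps)
  have a_dec: "a l \<le> a k" if "k \<le> l" for k l using that by (simp add: a_def frac_le)
  \<comment> \<open>Unlike \<open>- a k \<le> cosd z x\<close>, the homogeneous condition below passes to midpoints.\<close>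
  define S where "S = (\<lambda>k. {x\<in>X. c \<le> cosd p x \<and> (\<forall>z\<in>X. - (a k * cosd p x) \<le> cosd z x)})"
  have dec: "decseq S"
    unfolding decseq_def
  proof (intro allI impI subsetI)
    fix k l x assume "k \<le> l" "x \<in> S l"
    moreover from this have "a l * cosd p x \<le> a k * cosd p x"
      using c a_dec by (intro mult_right_mono) (auto simp: S_def)
    ultimately show "x \<in> S k" by (force simp: S_def)
  qed
  have S_ne: "\<exists>x\<in>S k. c \<le> cosd p x" for k
  proof -
    \<comment> \<open>The bound \<open>a k * c\<close> lets an almost center with error
      \<open>e\<close> satisfy the condition of \<open>S k\<close>, because
      \<open>c \<le> cosd p x\<close>.\<close>
    define e where "e = min (a k * c) 1"
    have e: "0 < e" "e \<le> 1" "e \<le> a k * c" using a c by (auto simp: e_def)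
    obtain x where x: "x \<in> X" "\<And>z. z \<in> X \<Longrightarrow> dist x z \<le> pi / 2 + e" "dist x p < pi / 2 - \<eta>"
      using near[OF e(1)] by blast
    have "c = cos (pi / 2 - \<eta>)" by (simp add: c_def cos_diff)
    also have "\<dots> \<le> cosd p x" using x(3) \<eta> \<eta>' diam[OF x(1) p] by (intro cosd_mono) auto
    finally have cp: "c \<le> cosd p x" .
    have "- (a k * cosd p x) \<le> cosd z x" if z: "z \<in> X" for z
    proof -
      have "- (a k * cosd p x) \<le> - (a k * c)" using cp a[of k] by simp
      also have "\<dots> \<le> - e" using e by simp
      also have "\<dots> \<le> - sin e" using e by (simp add: sin_x_le_x)
      also have "\<dots> = cos (pi / 2 + e)" by (simp add: cos_add)
      also have "\<dots> \<le> cosd z x" using x(2)[OF z] diam[OF x(1) z] e pi_gt3 by (intro cosd_mono) auto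
      finally show ?thesis .
    qed
    then show ?thesis using cp x(1) by (auto simp: S_def)
  qed
  \<comment> \<open>Since \<open>- 1/4\<close> exceeds \<open>cos (2 * pi / 3) = - 1/2\<close>, all
    distances from points of \<open>S k\<close> stay below a third of \<open>2 * pi\<close>; so the
    perimeter condition of the midpoint inequality holds. This is where \<open>a k \<le> 1/4\<close>
    enters.\<close>
  have S_dist: "dist x z < 2 * pi / 3" if "x \<in> S k" "z \<in> X" for x z k
  proof (rule ccontr)
    assume far: "\<not> dist x z < 2 * pi / 3"
    have xX: "x \<in> X" using that by (simp add: S_def)
    have "a k * cosd p x \<le> 1/4 * 1"
      using that(1) a[of k] c cosd_bounds[of p x] by (intro mult_mono) (auto simp: S_def)
    then have "- 1/4 \<le> cosd z x" using that by (force simp: S_def)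
    also have "\<dots> \<le> cos (2 * pi / 3)"
      unfolding cosd_def using far diam[OF xX that(2)] pi_gt_zero by (intro cos_monotone_0_pi_le) auto
    finally show False by (simp add: cos_120)
  qed
  have mid: "dist x y < pi \<and> (\<exists>m\<in>S k. cosd p x + cosd p y \<le> 2 * cos (dist x y / 2) * cosd p m)"
    if xy: "x \<in> S k" "y \<in> S k" for k x y
  proof -
    have xyX: "x \<in> X" "y \<in> X" using xy by (auto simp: S_def)
    have lt: "dist x y < pi" using S_dist[OF xy(1) xyX(2)] pi_gt_zero by linarith
    obtain m where m: "m \<in> X" "\<And>z. z \<in> X \<Longrightarrow> dist x y + dist x z + dist y z < 2 * pi \<Longrightarrow>
        cosd z x + cosd z y \<le> 2 * cos (dist x y / 2) * cosd z m"
      using CAT1_midpoint[OF cat xyX lt] by metis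
    have le: "cosd z x + cosd z y \<le> 2 * cos (dist x y / 2) * cosd z m" if z: "z \<in> X" for z
      using S_dist[OF xy(1) xyX(2)] S_dist[OF xy(1) z] S_dist[OF xy(2) z] by (intro m(2)[OF z]) linarith
    have C0: "0 < cos (dist x y / 2)"
      using lt pi_gt_zero zero_le_dist[of x y] by (intro cos_gt_zero_pi) linarith+
    have pm: "c \<le> cosd p m"
    proof -
      have 1: "c \<le> cos (dist x y / 2) * cosd p m" using le[OF p] xy by (simp add: S_def)
      then have "0 < cosd p m" using c C0 by (smt (verit) mult_nonneg_nonpos)
      then have "cos (dist x y / 2) * cosd p m \<le> 1 * cosd p m" by (intro mult_right_mono) auto
      then show ?thesis using 1 by simp
    qed
    have "- (a k * cosd p m) \<le> cosd z m" if z: "z \<in> X" for z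
    proof -
      have "0 \<le> (a k * cosd p x + cosd z x) + (a k * cosd p y + cosd z y)"
        using xy z by (force simp: S_def)
      also have "\<dots> = a k * (cosd p x + cosd p y) + (cosd z x + cosd z y)" by (simp add: algebra_simps)
      also have "\<dots> \<le> a k * (2 * cos (dist x y / 2) * cosd p m) + 2 * cos (dist x y / 2) * cosd z m"
        using le[OF p] le[OF z] a[of k] by (intro add_mono mult_left_mono) auto
      also have "\<dots> = 2 * cos (dist x y / 2) * (a k * cosd p m + cosd z m)" by (simp add: algebra_simps)
      finally have "0 \<le> a k * cosd p m + cosd z m" using C0 by (simp add: zero_le_mult_iff)
      then show ?thesis by linarith
    qed
    then have "m \<in> S k" using m(1) pm by (simp add: S_def)
    then show ?thesis using lt le[OF p] by blast
  qed
  \<comment> \<open>The sets shrink with \<open>k\<close>; as \<open>a k\<close> tends to 0, their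
    constraint becomes \<open>0 \<le> cosd z x\<close> at the limit point.\<close>
  obtain y where y: "\<And>k. y k \<in> S k" "Cauchy y"
  proof (rule Cauchy_near_maximizers[of S c "cosd p" 1])
    show "cosd p y \<le> 1" for y using cosd_bounds[of p y] by simp
  qed (use dec c S_ne mid in blast)+
  have "\<forall>k. y k \<in> X" using y(1) by (simp add: S_def)
  then obtain x where x: "x \<in> X" and lim: "y \<longlonglongrightarrow> x"
    using cat y(2) unfolding CAT1_def complete_def by metis
  have "dist x z \<le> pi / 2" if z: "z \<in> X" for z
  proof -
    have "(\<lambda>k. inverse (real (Suc k)) / 4 * cosd p (y k)) \<longlonglongrightarrow> 0 / 4 * cosd p x"
      by (intro tendsto_mult tendsto_divide LIMSEQ_inverse_real_of_nat tendsto_const tendsto_cosd lim) simp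
    then have "(\<lambda>k. - (a k * cosd p (y k))) \<longlonglongrightarrow> 0" unfolding a_def using tendsto_minus by fastforce
    moreover have "(\<lambda>k. cosd z (y k)) \<longlonglongrightarrow> cosd z x" by (intro tendsto_cosd lim)
    moreover have "\<exists>N. \<forall>k\<ge>N. - (a k * cosd p (y k)) \<le> cosd z (y k)" using y(1) z by (simp add: S_def)
    ultimately have "0 \<le> cosd z x" by (rule LIMSEQ_le)
    then show ?thesis using dist_le_half_pi_minus_cosd[of x z] diam[OF x z] by simp
  qed
  then show ?thesis using x by (auto simp: hemicenters_def)
qed

section \<open>Existence of a fixed circumcenter\<close>

theorem proposition1p4:
  fixes X :: "'a::metric_space set"
  assumes "CAT1 X"
    and "geometric_dim X < \<infinity>"
    and "radius X \<le> ereal (pi / 2)"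
  shows "\<exists>x. circumcenter X x \<and> (\<forall>f. isometry_of X f \<longrightarrow> f x = x)"
proof (cases "radius X < ereal (pi / 2)")
  case True
  then obtain q where q: "q \<in> X" "radius_at X q < ereal (pi / 2)"
    by (auto simp: radius_def INF_less_iff)
  then obtain \<rho> where \<rho>: "radius_at X q < ereal \<rho>" "\<rho> < pi / 2"
    using ereal_dense2[of "radius_at X q" "ereal (pi / 2)"] by auto
  have "dist q z \<le> \<rho>" if "z \<in> X" for z
    using SUP_lessD[OF \<rho>(1)[unfolded radius_at_def] that] by simp
  then show ?thesis using circumcenter_of_small_radius[OF assms(1) q(1) \<rho>(2)] by blast
next
  case False
  then have rad: "radius X = ereal (pi / 2)" using assms(3) by simp
  let ?C = "hemicenters X"
  have sub: "?C \<subseteq> X" by (auto simp: hemicenters_def)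
  have cat: "CAT1 ?C" using CAT1_hemicenters[OF assms(1)] .
  have dim: "geometric_dim ?C < \<infinity>" using geometric_dim_mono[OF sub] assms(2) by (rule le_less_trans)
  have "\<exists>x\<in>X. \<forall>z\<in>X. dist x z \<le> pi / 2 + \<epsilon>" if "0 < \<epsilon>" for \<epsilon>
  proof -
    have "radius X < ereal (pi / 2 + \<epsilon>)" using rad that by simp
    then obtain x where x: "x \<in> X" "radius_at X x < ereal (pi / 2 + \<epsilon>)"
      by (auto simp: radius_def INF_less_iff)
    then have "dist x z \<le> pi / 2 + \<epsilon>" if "z \<in> X" for z
      using SUP_lessD[OF x(2)[unfolded radius_at_def] that] by simp
    then show ?thesis using x(1) by blast
  qed
  then have ne: "?C \<noteq> {}" using hemicenter_exists[OF assms(1,2)] by blast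
  have diam: "dist x z \<le> pi / 2" if "x \<in> ?C" "z \<in> ?C" for x z
    using that by (auto simp: hemicenters_def)
  obtain P \<eta> where P: "finite P" "P \<subseteq> ?C" and \<eta>: "0 < \<eta>"
    and near: "\<And>y. y \<in> ?C \<Longrightarrow> \<forall>z\<in>?C. dist y z \<le> pi / 2 + \<eta> \<Longrightarrow> \<exists>p\<in>P. dist y p < pi / 2 - \<eta>"
    using finite_dim_obstruction[OF cat dim] by metis
  \<comment> \<open>Inside \<open>hemicenters X\<close> the diameter bound supplies the hypothesis
    on \<open>y\<close>, so the obstruction holds at every point.\<close>
  have near: "\<exists>p\<in>P. dist y p < pi / 2 - \<eta>" if "y \<in> ?C" for y
    using near[OF that] diam[OF that] \<eta> by force
  have "P \<noteq> {}" using near ne by blast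
  then obtain q \<kappa> where q: "q \<in> ?C" "0 < \<kappa>" "\<forall>x\<in>?C. \<forall>p\<in>P. \<kappa> * cosd x p \<le> cosd x q"
    using common_near_point[OF cat diam P(1) _ P(2)] by blast
  have \<eta>2: "\<eta> < pi / 2"
  proof -
    obtain p where "dist q p < pi / 2 - \<eta>" using near[OF q(1)] by blast
    then show ?thesis using zero_le_dist[of q p] by linarith
  qed
  \<comment> \<open>Every \<open>z\<close> is near some point of \<open>P\<close>, and
    \<open>q\<close> inherits a fixed fraction of that cosine, so its gap below a right angle is
    uniform in \<open>z\<close>.\<close>
  have "dist q z \<le> pi / 2 - \<kappa> * sin \<eta>" if z: "z \<in> ?C" for z
  proof -
    obtain p where p: "p \<in> P" "dist z p < pi / 2 - \<eta>" using near[OF z] by blast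
    have "sin \<eta> = cos (pi / 2 - \<eta>)" by (simp add: cos_diff)
    also have "\<dots> \<le> cosd z p"
      using p(2) \<eta> \<eta>2 by (intro cosd_mono) (auto simp: dist_commute)
    finally have "\<kappa> * sin \<eta> \<le> \<kappa> * cosd z p" using q(2) by simp
    also have "\<dots> \<le> cosd z q" using q(3) z p(1) by blast
    finally have *: "\<kappa> * sin \<eta> \<le> cosd z q" .
    moreover have "0 < sin \<eta>" using \<eta> \<eta>2 by (intro sin_gt_zero) auto
    ultimately have "0 \<le> cosd z q" using q(2) by (smt (verit) mult_pos_pos)
    then have "dist q z \<le> pi / 2 - cosd z q"
      using diam[OF q(1) z] pi_gt_zero by (intro dist_le_half_pi_minus_cosd) linarith+
    then show ?thesis using * by linarith
  qed
  moreover have "pi / 2 - \<kappa> * sin \<eta> < pi / 2"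
    using q(2) \<eta> \<eta>2 by (simp add: sin_gt_zero)
  ultimately obtain x where x: "circumcenter ?C x" "\<And>f. isometry_of ?C f \<Longrightarrow> f x = x"
    using circumcenter_of_small_radius[OF cat q(1)] by blast
  have xC: "x \<in> ?C" using x(1) by (simp add: circumcenter_def)
  have "radius_at X x \<le> ereal (pi / 2)"
    unfolding radius_at_def using xC by (intro SUP_least) (simp add: hemicenters_def)
  moreover have "radius X \<le> radius_at X x"
    unfolding radius_def using xC sub by (intro INF_lower) auto
  ultimately have "circumcenter X x" using xC sub rad by (auto simp: circumcenter_def)
  moreover have "f x = x" if f: "isometry_of X f" for f
  proof (rule x(2))
    have fX: "f ` X = X" and fd: "\<And>y z. y \<in> X \<Longrightarrow> z \<in> X \<Longrightarrow> dist (f y) (f z) = dist y z"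
      using f by (auto simp: isometry_of_def)
    \<comment> \<open>Surjectivity makes \<open>f\<close> preserve the condition defining
      \<open>hemicenters X\<close>, so \<open>f\<close> restricts to an isometry of that set and
      fixes \<open>x\<close>.\<close>
    have iff: "f y \<in> ?C \<longleftrightarrow> y \<in> ?C" if y: "y \<in> X" for y
    proof -
      have "(\<forall>z\<in>X. dist (f y) z \<le> pi / 2) \<longleftrightarrow> (\<forall>z\<in>f ` X. dist (f y) z \<le> pi / 2)"
        by (simp only: fX)
      also have "\<dots> \<longleftrightarrow> (\<forall>z\<in>X. dist y z \<le> pi / 2)" using fd[OF y] by simp
      finally show ?thesis using y fX by (auto simp: hemicenters_def)
    qed
    have "f ` ?C = ?C"
    proof
      show "f ` ?C \<subseteq> ?C" using iff sub by blast
      show "?C \<subseteq> f ` ?C"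
      proof
        fix y assume y: "y \<in> ?C"
        then have "y \<in> f ` X" using sub fX by auto
        then obtain w where w: "w \<in> X" "y = f w" by blast
        then show "y \<in> f ` ?C" using iff[OF w(1)] y by blast
      qed
    qed
    then show "isometry_of ?C f" using fd sub unfolding isometry_of_def by blast
  qed
  ultimately show ?thesis by blast
qed

end
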